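(* Let $p:(\mathcal D,K)\to(\mathcal C,J)$ be a local fibration and $f:d'\to d$ an arrow in $\mathcal D$. There are a $K$-covering family $(v_i:d'_i\to d')_i$, a family $(\widehat{f_i}:d_i\to d)_i$ of locally cartesian arrows, arrows $a_i:d'_i\to d_i$ in $\mathcal D$ and arrows $s_i:p(d_i)\to p(d')$ in $\mathcal C$ such that, for every $i$, $fv_i=\widehat{f_i}a_i$ and $p(f)s_i=p(\widehat{f_i})$.
   Context: Sites are such that their categories of sheaves are Grothendieck toposes. For a site $(\mathcal C,J)$: $\widehat{\mathcal C}_J$ is the topos of sheaves, $a_J$ is sheafification, $l_J:\mathcal C\to\widehat{\mathcal C}_J$ is Yoneda followed by $a_J$. A comorphism of sites $p:(\mathcal D,K)\to(\mathcal C,J)$ is a functor such that every $J$-covering sieve on $p(d)$ contains the image $p(R)$ of a $K$-covering sieve $R$ on $d$; it induces a geometric morphism $C_p:\widehat{\mathcal D}_K\to\widehat{\mathcal C}_J$ with $C_p^*(E)=a_K(E\circ p^{op})$. For an object $d$ of $\mathcal D$ let $\eta(d):l_K(d)\to C_p^*l_Jp(d)\simeq a_K(\mathrm{Hom}_{\mathcal C}(p(-),p(d)))$ be the sheafification of $g\mapsto p(g)$. An arrow $g:d'\to d$ of $\mathcal D$ is locally cartesian if $\eta_{\mathcal D}(g)=(l_K(g),l_Jp(g)):(l_K(d'),l_Jp(d'),\eta(d'))\to(l_K(d),l_Jp(d),\eta(d))$ is a cartesian arrow of the comma category $(\widehat{\mathcal D}_K/C_p^* )$ fibred over $\widehat{\mathcal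 C}_J$; equivalently, if the square formed by $l_K(g)$, $\eta(d')$, $\eta(d)$, $C_p^*l_Jp(g)$ is a pullback in $\widehat{\mathcal D}_K$. A comorphism of sites $p$ is a local fibration if for every $u:c\to p(d)$ in $\mathcal C$ there are a $J$-covering family $(u_i:p(d_i)\to c)_i$ and locally cartesian arrows $\widehat{u_i}:d_i\to d$ with $uu_i=p(\widehat{u_i})$ for all $i$. *)

theory Defs
  imports Main "HOL-Library.FuncSet"
begin

section \<open>Categories, functors and cartesian arrows\<close>

record ('o, 'a) cat =
  Obj :: "'o set"
  Arr :: "'a set"
  Dom :: "'a \<Rightarrow> 'o"
  Cod :: "'a \<Rightarrow> 'o"
  Ident :: "'o \<Rightarrow> 'a"
  Comp :: "'a \<Rightarrow> 'a \<Rightarrow> 'a"  (infixl "\<cdot>\<index>" 70)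

definition hom :: "('o, 'a, 'm) cat_scheme \<Rightarrow> 'o \<Rightarrow> 'o \<Rightarrow> 'a set" where
  "hom C x y = {f \<in> Arr C. Dom C f = x \<and> Cod C f = y}"

locale category =
  fixes C :: "('o, 'a) cat" (structure)
  assumes dom_obj: "f \<in> Arr C \<Longrightarrow> Dom C f \<in> Obj C"
    and cod_obj: "f \<in> Arr C \<Longrightarrow> Cod C f \<in> Obj C"
    and ident_hom: "x \<in> Obj C \<Longrightarrow> Ident C x \<in> hom C x x"
    and comp_hom: "\<lbrakk>f \<in> hom C x y; g \<in> hom C y z\<rbrakk> \<Longrightarrow> g \<cdot> f \<in> hom C x z"
    and ident_left: "f \<in> hom C x y \<Longrightarrow> Ident C y \<cdot> f = f"
    and ident_right: "f \<in> hom C x y \<Longrightarrow> f \<cdot> Ident C x = f"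
    and comp_assoc:
      "\<lbrakk>f \<in> hom C w x; g \<in> hom C x y; h \<in> hom C y z\<rbrakk> \<Longrightarrow> (h \<cdot> g) \<cdot> f = h \<cdot> (g \<cdot> f)"

record ('o, 'a, 'p, 'b) cat_map =
  on_obj :: "'o \<Rightarrow> 'p"
  on_arr :: "'a \<Rightarrow> 'b"

locale cat_functor = source: category D + target: category C
  for D :: "('p, 'b) cat" and C :: "('o, 'a) cat" and p :: "('p, 'b, 'o, 'a) cat_map" +
  assumes map_obj: "d \<in> Obj D \<Longrightarrow> on_obj p d \<in> Obj C"
    and map_hom: "g \<in> hom D x y \<Longrightarrow> on_arr p g \<in> hom C (on_obj p x) (on_obj p y)"
    and map_ident: "d \<in> Obj D \<Longrightarrow> on_arr p (Ident D d) = Ident C (on_obj p d)"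
    and map_comp: "\<lbrakk>f \<in> hom D x y; g \<in> hom D y z\<rbrakk> \<Longrightarrow>
      on_arr p (g \<cdot>\<^bsub>D\<^esub> f) = on_arr p g \<cdot>\<^bsub>C\<^esub> on_arr p f"

definition cartesian_arrow ::
  "('p, 'b) cat \<Rightarrow> ('o, 'a) cat \<Rightarrow> ('p, 'b, 'o, 'a) cat_map \<Rightarrow> 'b \<Rightarrow> bool" where
  "cartesian_arrow E B P g \<longleftrightarrow> g \<in> Arr E \<and>
    (\<forall>h \<in> Arr E. \<forall>w \<in> hom B (on_obj P (Dom E h)) (on_obj P (Dom E g)).
      Cod E h = Cod E g \<and> on_arr P g \<cdot>\<^bsub>B\<^esub> w = on_arr P h \<longrightarrow>
      (\<exists>!k. k \<in> hom E (Dom E h) (Dom E g) \<and> g \<cdot>\<^bsub>E\<^esub> k = h \<and> on_arr P k = w))"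


section \<open>Sites and comorphisms of sites\<close>

definition sieve :: "('o, 'a) cat \<Rightarrow> 'o \<Rightarrow> 'a set \<Rightarrow> bool" where
  "sieve C c S \<longleftrightarrow> S \<subseteq> {f \<in> Arr C. Cod C f = c} \<and>
    (\<forall>f \<in> S. \<forall>g \<in> Arr C. Cod C g = Dom C f \<longrightarrow> f \<cdot>\<^bsub>C\<^esub> g \<in> S)"

definition pullback_sieve :: "('o, 'a) cat \<Rightarrow> 'a \<Rightarrow> 'a set \<Rightarrow> 'a set" where
  "pullback_sieve C f S = {g \<in> Arr C. Cod C g = Dom C f \<and> f \<cdot>\<^bsub>C\<^esub> g \<in> S}"

definition generated_sieve :: "('o, 'a) cat \<Rightarrow> 'a set \<Rightarrow> 'a set" where
  "generated_sieve C V = {f \<cdot>\<^bsub>C\<^esub> g |f g. f \<in> V \<and> g \<in> Arr C \<and> Cod C g = Dom C f}"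

locale site = category C for C :: "('o, 'a) cat" (structure) +
  fixes J :: "'o \<Rightarrow> 'a set set"
  assumes covering_sieve: "\<lbrakk>c \<in> Obj C; S \<in> J c\<rbrakk> \<Longrightarrow> sieve C c S"
    and maximal: "c \<in> Obj C \<Longrightarrow> {f \<in> Arr C. Cod C f = c} \<in> J c"
    and stability: "\<lbrakk>f \<in> Arr C; S \<in> J (Cod C f)\<rbrakk> \<Longrightarrow> pullback_sieve C f S \<in> J (Dom C f)"
    and transitivity: "\<lbrakk>c \<in> Obj C; S \<in> J c; sieve C c R;
      \<And>f. f \<in> S \<Longrightarrow> pullback_sieve C f R \<in> J (Dom C f)\<rbrakk> \<Longrightarrow> R \<in> J c"

definition covering_family ::
  "('o, 'a) cat \<Rightarrow> ('o \<Rightarrow> 'a set set) \<Rightarrow> 'o \<Rightarrow> 'i set \<Rightarrow> ('i \<Rightarrow> 'a) \<Rightarrow> bool" where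
  "covering_family C J c I u \<longleftrightarrow>
    (\<forall>i \<in> I. u i \<in> Arr C \<and> Cod C (u i) = c) \<and> generated_sieve C (u ` I) \<in> J c"

locale comorphism_of_sites =
  source: site D K + target: site C J + cat_functor D C p
  for D :: "('p, 'b) cat" and K :: "'p \<Rightarrow> 'b set set"
    and C :: "('o, 'a) cat" and J :: "'o \<Rightarrow> 'a set set"
    and p :: "('p, 'b, 'o, 'a) cat_map" +
  assumes cover_lifting: "\<lbrakk>d \<in> Obj D; S \<in> J (on_obj p d)\<rbrakk> \<Longrightarrow> \<exists>R \<in> K d. on_arr p ` R \<subseteq> S"


section \<open>Presheaves and sheaves of sets\<close>

text \<open>
  A presheaf takes values in subsets of a type. Morphisms may relate presheaves with values
  in different types; they are extensional families of extensional functions, so that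
  equality of morphisms is equality in HOL.
\<close>

record ('o, 'a, 'x) presheaf =
  Sec :: "'o \<Rightarrow> 'x set"
  Res :: "'a \<Rightarrow> 'x \<Rightarrow> 'x"

definition is_presheaf :: "('o, 'a) cat \<Rightarrow> ('o, 'a, 'x) presheaf \<Rightarrow> bool" where
  "is_presheaf C F \<longleftrightarrow>
    (\<forall>f \<in> Arr C. Res F f \<in> Sec F (Cod C f) \<rightarrow> Sec F (Dom C f)) \<and>
    (\<forall>c \<in> Obj C. \<forall>x \<in> Sec F c. Res F (Ident C c) x = x) \<and>
    (\<forall>f \<in> Arr C. \<forall>g \<in> Arr C. Cod C g = Dom C f \<longrightarrow>
      (\<forall>x \<in> Sec F (Cod C f). Res F (f \<cdot>\<^bsub>C\<^esub> g) x = Res F g (Res F f x)))"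

definition psh_hom ::
  "('o, 'a) cat \<Rightarrow> ('o, 'a, 'x) presheaf \<Rightarrow> ('o, 'a, 'y) presheaf \<Rightarrow> ('o \<Rightarrow> 'x \<Rightarrow> 'y) set" where
  "psh_hom C F G = {\<alpha> \<in> (\<Pi>\<^sub>E c \<in> Obj C. Sec F c \<rightarrow>\<^sub>E Sec G c).
    \<forall>f \<in> Arr C. \<forall>x \<in> Sec F (Cod C f). \<alpha> (Dom C f) (Res F f x) = Res G f (\<alpha> (Cod C f) x)}"

definition psh_id :: "('o, 'a) cat \<Rightarrow> ('o, 'a, 'x) presheaf \<Rightarrow> 'o \<Rightarrow> 'x \<Rightarrow> 'x" where
  "psh_id C F = (\<lambda>c \<in> Obj C. \<lambda>x \<in> Sec F c. x)"

definition psh_comp ::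
  "('o, 'a) cat \<Rightarrow> ('o, 'a, 'x) presheaf \<Rightarrow> ('o \<Rightarrow> 'y \<Rightarrow> 'z) \<Rightarrow> ('o \<Rightarrow> 'x \<Rightarrow> 'y) \<Rightarrow> 'o \<Rightarrow> 'x \<Rightarrow> 'z" where
  "psh_comp C F \<beta> \<alpha> = (\<lambda>c \<in> Obj C. \<lambda>x \<in> Sec F c. \<beta> c (\<alpha> c x))"

text \<open>A family of sections indexed by a sieve is a partial map whose domain is the sieve.\<close>

definition matching_family :: "('o, 'a) cat \<Rightarrow> ('o, 'a, 'x) presheaf \<Rightarrow> ('a \<rightharpoonup> 'x) \<Rightarrow> bool" where
  "matching_family C F m \<longleftrightarrow> (\<forall>f \<in> dom m. the (m f) \<in> Sec F (Dom C f) \<and>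
    (\<forall>g \<in> Arr C. Cod C g = Dom C f \<longrightarrow> m (f \<cdot>\<^bsub>C\<^esub> g) = Some (Res F g (the (m f)))))"

definition is_sheaf :: "('o, 'a) cat \<Rightarrow> ('o \<Rightarrow> 'a set set) \<Rightarrow> ('o, 'a, 'x) presheaf \<Rightarrow> bool" where
  "is_sheaf C J F \<longleftrightarrow> is_presheaf C F \<and>
    (\<forall>c \<in> Obj C. \<forall>m. dom m \<in> J c \<and> matching_family C F m \<longrightarrow>
      (\<exists>!x. x \<in> Sec F c \<and> (\<forall>f \<in> dom m. m f = Some (Res F f x))))"

text \<open>Arrows of the category of sheaves are triples (source, transformation, target).\<close>

type_synonym ('o, 'a, 'x) psh_arrow =
  "('o, 'a, 'x) presheaf \<times> ('o \<Rightarrow> 'x \<Rightarrow> 'x) \<times> ('o, 'a, 'x) presheaf"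

definition sheaf_cat ::
  "('o, 'a) cat \<Rightarrow> ('o \<Rightarrow> 'a set set) \<Rightarrow>
    (('o, 'a, 'x) presheaf, ('o, 'a, 'x) psh_arrow) cat" where
  "sheaf_cat C J =
    \<lparr>Obj = {F. is_sheaf C J F},
     Arr = {(F, \<alpha>, G). is_sheaf C J F \<and> is_sheaf C J G \<and> \<alpha> \<in> psh_hom C F G},
     Dom = (\<lambda>(F, \<alpha>, G). F),
     Cod = (\<lambda>(F, \<alpha>, G). G),
     Ident = (\<lambda>F. (F, psh_id C F, F)),
     Comp = (\<lambda>(G, \<beta>, H) (F, \<alpha>, G'). (F, psh_comp C F \<beta> \<alpha>, H))\<rparr>"


section \<open>Sheafification\<close>

text \<open>
  The plus construction: sections of the new presheaf over an object are the matching families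
  on covering sieves of that object, two families being identified when they agree on a
  common covering subsieve. Sheafification applies it twice. As all definitions of functions
  on classes below respect the equivalence, they can be written as the saturation of a direct
  image.
\<close>

definition match_rel ::
  "('o, 'a) cat \<Rightarrow> ('o \<Rightarrow> 'a set set) \<Rightarrow> ('o, 'a, 'x) presheaf \<Rightarrow> 'o \<Rightarrow> ('a \<rightharpoonup> 'x) rel" where
  "match_rel C J F c = {(m, m').
    dom m \<in> J c \<and> matching_family C F m \<and> dom m' \<in> J c \<and> matching_family C F m' \<and>
    (\<exists>R \<in> J c. R \<subseteq> dom m \<inter> dom m' \<and> (\<forall>f \<in> R. m f = m' f))}"

definition restrict_family :: "('o, 'a) cat \<Rightarrow> 'a \<Rightarrow> ('a \<rightharpoonup> 'x) \<Rightarrow> 'a \<rightharpoonup> 'x" where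
  "restrict_family C g m = (\<lambda>f. if f \<in> Arr C \<and> Cod C f = Dom C g then m (g \<cdot>\<^bsub>C\<^esub> f) else None)"

type_synonym ('a, 'x) plus = "('a \<rightharpoonup> 'x) set"

definition plus_psh ::
  "('o, 'a) cat \<Rightarrow> ('o \<Rightarrow> 'a set set) \<Rightarrow> ('o, 'a, 'x) presheaf \<Rightarrow>
    ('o, 'a, ('a, 'x) plus) presheaf" where
  "plus_psh C J F =
    \<lparr>Sec = (\<lambda>c. {m. dom m \<in> J c \<and> matching_family C F m} // match_rel C J F c),
     Res = (\<lambda>g X. match_rel C J F (Dom C g) `` (restrict_family C g ` X))\<rparr>"

definition plus_unit ::
  "('o, 'a) cat \<Rightarrow> ('o \<Rightarrow> 'a set set) \<Rightarrow> ('o, 'a, 'x) presheaf \<Rightarrow> 'o \<Rightarrow> 'x \<Rightarrow> ('a, 'x) plus" where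
  "plus_unit C J F = (\<lambda>c \<in> Obj C. \<lambda>x \<in> Sec F c. match_rel C J F c ``
    {\<lambda>f. if f \<in> Arr C \<and> Cod C f = c then Some (Res F f x) else None})"

definition plus_map ::
  "('o, 'a) cat \<Rightarrow> ('o \<Rightarrow> 'a set set) \<Rightarrow> ('o, 'a, 'x) presheaf \<Rightarrow> ('o, 'a, 'y) presheaf \<Rightarrow>
    ('o \<Rightarrow> 'x \<Rightarrow> 'y) \<Rightarrow> 'o \<Rightarrow> ('a, 'x) plus \<Rightarrow> ('a, 'y) plus" where
  "plus_map C J F G \<alpha> = (\<lambda>c \<in> Obj C. \<lambda>X \<in> Sec (plus_psh C J F) c.
    match_rel C J G c `` ((\<lambda>m f. map_option (\<alpha> (Dom C f)) (m f)) ` X))"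

type_synonym ('a, 'x) shf = "('a, ('a, 'x) plus) plus"

definition sheafify ::
  "('o, 'a) cat \<Rightarrow> ('o \<Rightarrow> 'a set set) \<Rightarrow> ('o, 'a, 'x) presheaf \<Rightarrow>
    ('o, 'a, ('a, 'x) shf) presheaf" where
  "sheafify C J F = plus_psh C J (plus_psh C J F)"

definition sheafify_unit ::
  "('o, 'a) cat \<Rightarrow> ('o \<Rightarrow> 'a set set) \<Rightarrow> ('o, 'a, 'x) presheaf \<Rightarrow> 'o \<Rightarrow> 'x \<Rightarrow> ('a, 'x) shf" where
  "sheafify_unit C J F = psh_comp C F (plus_unit C J (plus_psh C J F)) (plus_unit C J F)"

definition sheafify_map ::
  "('o, 'a) cat \<Rightarrow> ('o \<Rightarrow> 'a set set) \<Rightarrow> ('o, 'a, 'x) presheaf \<Rightarrow> ('o, 'a, 'y) presheaf \<Rightarrow>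
    ('o \<Rightarrow> 'x \<Rightarrow> 'y) \<Rightarrow> 'o \<Rightarrow> ('a, 'x) shf \<Rightarrow> ('a, 'y) shf" where
  "sheafify_map C J F G \<alpha> =
    plus_map C J (plus_psh C J F) (plus_psh C J G) (plus_map C J F G \<alpha>)"

definition yoneda :: "('o, 'a) cat \<Rightarrow> 'o \<Rightarrow> ('o, 'a, 'a) presheaf" where
  "yoneda C c = \<lparr>Sec = (\<lambda>x. hom C x c), Res = (\<lambda>f g. g \<cdot>\<^bsub>C\<^esub> f)\<rparr>"

definition yoneda_map :: "('o, 'a) cat \<Rightarrow> 'a \<Rightarrow> 'o \<Rightarrow> 'a \<Rightarrow> 'a" where
  "yoneda_map C f = (\<lambda>x \<in> Obj C. \<lambda>g \<in> hom C x (Dom C f). f \<cdot>\<^bsub>C\<^esub> g)"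

text \<open>The canonical functor from a site to its topos of sheaves, on objects and arrows.\<close>

definition l_obj ::
  "('o, 'a) cat \<Rightarrow> ('o \<Rightarrow> 'a set set) \<Rightarrow> 'o \<Rightarrow> ('o, 'a, ('a, 'a) shf) presheaf" where
  "l_obj C J c = sheafify C J (yoneda C c)"

definition l_map ::
  "('o, 'a) cat \<Rightarrow> ('o \<Rightarrow> 'a set set) \<Rightarrow> 'a \<Rightarrow> 'o \<Rightarrow> ('a, 'a) shf \<Rightarrow> ('a, 'a) shf" where
  "l_map C J f =
    sheafify_map C J (yoneda C (Dom C f)) (yoneda C (Cod C f)) (yoneda_map C f)"


section \<open>The inverse image of a comorphism and its comma category\<close>

definition precomp ::
  "('p, 'b, 'o, 'a) cat_map \<Rightarrow> ('o, 'a, 'x) presheaf \<Rightarrow> ('p, 'b, 'x) presheaf" where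
  "precomp p E = \<lparr>Sec = (\<lambda>d. Sec E (on_obj p d)), Res = (\<lambda>g. Res E (on_arr p g))\<rparr>"

definition inv_image_obj ::
  "('p, 'b) cat \<Rightarrow> ('p \<Rightarrow> 'b set set) \<Rightarrow> ('p, 'b, 'o, 'a) cat_map \<Rightarrow>
    ('o, 'a, 'x) presheaf \<Rightarrow> ('p, 'b, ('b, 'x) shf) presheaf" where
  "inv_image_obj D K p E = sheafify D K (precomp p E)"

definition inv_image_map ::
  "('p, 'b) cat \<Rightarrow> ('p \<Rightarrow> 'b set set) \<Rightarrow> ('p, 'b, 'o, 'a) cat_map \<Rightarrow>
    ('o, 'a, 'x) presheaf \<Rightarrow> ('o, 'a, 'y) presheaf \<Rightarrow>
    ('o \<Rightarrow> 'x \<Rightarrow> 'y) \<Rightarrow> 'p \<Rightarrow> ('b, 'x) shf \<Rightarrow> ('b, 'y) shf" where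
  "inv_image_map D K p E E' k =
    sheafify_map D K (precomp p E) (precomp p E') (\<lambda>d \<in> Obj D. k (on_obj p d))"

text \<open>
  Objects are triples (F, E, \<open>\<phi>\<close>) with \<open>\<phi>\<close> a morphism from F to the inverse image of E;
  arrows are quadruples (source, h, k, target).
\<close>

type_synonym ('p, 'b, 'x, 'o, 'a, 'y) comma_obj =
  "('p, 'b, 'x) presheaf \<times> ('o, 'a, 'y) presheaf \<times> ('p \<Rightarrow> 'x \<Rightarrow> ('b, 'y) shf)"

type_synonym ('p, 'b, 'x, 'o, 'a, 'y) comma_arrow =
  "('p, 'b, 'x, 'o, 'a, 'y) comma_obj \<times> ('p \<Rightarrow> 'x \<Rightarrow> 'x) \<times> ('o \<Rightarrow> 'y \<Rightarrow> 'y) \<times>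
    ('p, 'b, 'x, 'o, 'a, 'y) comma_obj"

definition comma_objs ::
  "('p, 'b) cat \<Rightarrow> ('p \<Rightarrow> 'b set set) \<Rightarrow> ('o, 'a) cat \<Rightarrow> ('o \<Rightarrow> 'a set set) \<Rightarrow>
    ('p, 'b, 'o, 'a) cat_map \<Rightarrow> ('p, 'b, 'x, 'o, 'a, 'y) comma_obj set" where
  "comma_objs D K C J p = {(F, E, \<phi>). is_sheaf D K F \<and> is_sheaf C J E \<and>
    \<phi> \<in> psh_hom D F (inv_image_obj D K p E)}"

definition comma_cat ::
  "('p, 'b) cat \<Rightarrow> ('p \<Rightarrow> 'b set set) \<Rightarrow> ('o, 'a) cat \<Rightarrow> ('o \<Rightarrow> 'a set set) \<Rightarrow>
    ('p, 'b, 'o, 'a) cat_map \<Rightarrow>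
    (('p, 'b, 'x, 'o, 'a, 'y) comma_obj, ('p, 'b, 'x, 'o, 'a, 'y) comma_arrow) cat" where
  "comma_cat D K C J p =
    \<lparr>Obj = comma_objs D K C J p,
     Arr = {((F, E, \<phi>), h, k, (F', E', \<phi>')).
       (F, E, \<phi>) \<in> comma_objs D K C J p \<and> (F', E', \<phi>') \<in> comma_objs D K C J p \<and>
       h \<in> psh_hom D F F' \<and> k \<in> psh_hom C E E' \<and>
       psh_comp D F \<phi>' h = psh_comp D F (inv_image_map D K p E E' k) \<phi>},
     Dom = (\<lambda>(X, h, k, Y). X),
     Cod = (\<lambda>(X, h, k, Y). Y),
     Ident = (\<lambda>(F, E, \<phi>). ((F, E, \<phi>), psh_id D F, psh_id C E, (F, E, \<phi>))),
     Comp = (\<lambda>(Y, h', k', Z) ((F, E, \<phi>), h, k, Y').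
       ((F, E, \<phi>), psh_comp D F h' h, psh_comp C E k' k, Z))\<rparr>"

definition comma_proj ::
  "(('p, 'b, 'x, 'o, 'a, 'y) comma_obj, ('p, 'b, 'x, 'o, 'a, 'y) comma_arrow,
    ('o, 'a, 'y) presheaf, ('o, 'a, 'y) psh_arrow) cat_map" where
  "comma_proj =
    \<lparr>on_obj = (\<lambda>(F, E, \<phi>). E),
     on_arr = (\<lambda>((F, E, \<phi>), h, k, (F', E', \<phi>')). (E, k, E'))\<rparr>"


section \<open>Locally cartesian arrows and local fibrations\<close>

text \<open>
  The sheafification of \<open>g \<mapsto> p g\<close>, followed by the sheafification of the
  unit of \<open>l_obj C J (p d)\<close> restricted along \<open>p\<close>. For a comorphism of sites the latter is the
  canonical isomorphism from the sheafification of \<open>Hom (p -, p d)\<close> to the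
  inverse image of \<open>l_obj C J (p d)\<close>.
\<close>

definition eta ::
  "('p, 'b) cat \<Rightarrow> ('p \<Rightarrow> 'b set set) \<Rightarrow> ('o, 'a) cat \<Rightarrow> ('o \<Rightarrow> 'a set set) \<Rightarrow>
    ('p, 'b, 'o, 'a) cat_map \<Rightarrow> 'p \<Rightarrow> 'p \<Rightarrow> ('b, 'b) shf \<Rightarrow> ('b, ('a, 'a) shf) shf" where
  "eta D K C J p d =
    sheafify_map D K (yoneda D d) (precomp p (l_obj C J (on_obj p d)))
      (\<lambda>x \<in> Obj D. \<lambda>g \<in> hom D x d.
        sheafify_unit C J (yoneda C (on_obj p d)) (on_obj p x) (on_arr p g))"

definition eta_obj ::
  "('p, 'b) cat \<Rightarrow> ('p \<Rightarrow> 'b set set) \<Rightarrow> ('o, 'a) cat \<Rightarrow> ('o \<Rightarrow> 'a set set) \<Rightarrow>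
    ('p, 'b, 'o, 'a) cat_map \<Rightarrow> 'p \<Rightarrow> ('p, 'b, ('b, 'b) shf, 'o, 'a, ('a, 'a) shf) comma_obj" where
  "eta_obj D K C J p d = (l_obj D K d, l_obj C J (on_obj p d), eta D K C J p d)"

definition eta_arr ::
  "('p, 'b) cat \<Rightarrow> ('p \<Rightarrow> 'b set set) \<Rightarrow> ('o, 'a) cat \<Rightarrow> ('o \<Rightarrow> 'a set set) \<Rightarrow>
    ('p, 'b, 'o, 'a) cat_map \<Rightarrow> 'b \<Rightarrow>
    ('p, 'b, ('b, 'b) shf, 'o, 'a, ('a, 'a) shf) comma_arrow" where
  "eta_arr D K C J p g =
    (eta_obj D K C J p (Dom D g), l_map D K g, l_map C J (on_arr p g),
     eta_obj D K C J p (Cod D g))"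

text \<open>
  The comma category is formed from the sheaves with values in the types
  \<open>('b, 'b) shf\<close> and \<open>('a, 'a) shf\<close>. These include \<open>l_obj D K d\<close> and \<open>l_obj C J c\<close> for all
  \<open>d\<close> and \<open>c\<close>. Allowing sheaves with values in larger types would give the same cartesian
  arrows: a test object over \<open>w\<close> can be replaced by its composite with the inverse image of \<open>w\<close>,
  which lies over \<open>l_obj C J (p d')\<close>, and the sheaves \<open>l_obj D K d\<close> generate.
\<close>

definition locally_cartesian ::
  "('p, 'b) cat \<Rightarrow> ('p \<Rightarrow> 'b set set) \<Rightarrow> ('o, 'a) cat \<Rightarrow> ('o \<Rightarrow> 'a set set) \<Rightarrow>
    ('p, 'b, 'o, 'a) cat_map \<Rightarrow> 'b \<Rightarrow> bool" where
  "locally_cartesian D K C J p g \<longleftrightarrow> g \<in> Arr D \<and>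
    cartesian_arrow (comma_cat D K C J p) (sheaf_cat C J) comma_proj (eta_arr D K C J p g)"

text \<open>
  Covering families are indexed by subsets of the type of arrows of \<open>C\<close>. This is no
  restriction: in any such family repeated arrows may be dropped.
\<close>

locale local_fibration = comorphism_of_sites D K C J p
  for D :: "('p, 'b) cat" and K :: "'p \<Rightarrow> 'b set set"
    and C :: "('o, 'a) cat" and J :: "'o \<Rightarrow> 'a set set"
    and p :: "('p, 'b, 'o, 'a) cat_map" +
  assumes local_lifting: "\<lbrakk>d \<in> Obj D; u \<in> hom C c (on_obj p d)\<rbrakk> \<Longrightarrow>
    \<exists>(I :: 'a set) dd uu uhat.
      covering_family C J c I uu \<and>
      (\<forall>i \<in> I. dd i \<in> Obj D \<and> uu i \<in> hom C (on_obj p (dd i)) c \<and>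
        uhat i \<in> hom D (dd i) d \<and> locally_cartesian D K C J p (uhat i) \<and>
        u \<cdot>\<^bsub>C\<^esub> uu i = on_arr p (uhat i))"

end

theory Submission
  imports Defs
begin

text \<open>
  Apply the local lifting property to \<open>p f\<close>: it gives arrows \<open>s\<^sub>i : p d\<^sub>i \<rightarrow> p d'\<close> that cover \<open>p d'\<close>, and
  locally cartesian arrows \<open>u\<^sub>i : d\<^sub>i \<rightarrow> d\<close> with \<open>p f \<cdot> s\<^sub>i = p u\<^sub>i\<close>. Since \<open>p\<close> is a comorphism, a
  covering sieve of \<open>d'\<close> consists of arrows \<open>w : e \<rightarrow> d'\<close> with \<open>p w = s\<^sub>i \<cdot> t\<close> for some \<open>i\<close> and \<open>t\<close>.
  Then \<open>p (f w) = p u\<^sub>i \<cdot> t\<close>. If \<open>u\<^sub>i\<close> were cartesian for \<open>p\<close>, the arrow \<open>f w\<close> would factor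
  through it. It is only locally cartesian, so what factors is the arrow \<open>l_map (f w)\<close> between
  sheaves: the image of \<open>f w\<close> in the comma category lies over \<open>l_map (p u\<^sub>i) \<cdot> l_map t\<close>, and
  cartesianness of the image of \<open>u\<^sub>i\<close> gives \<open>\<kappa> : l e \<rightarrow> l d\<^sub>i\<close> with \<open>l_map u\<^sub>i \<cdot> \<kappa> = l_map (f w)\<close>.

  Sections of a sheafification come locally from the presheaf, and sections of the presheaf that
  become equal there agree locally. Evaluating \<open>\<kappa>\<close> at the class of the identity of \<open>e\<close>
  therefore yields a covering sieve of \<open>e\<close> on which \<open>f w\<close> factors through \<open>u\<^sub>i\<close> in the category
  itself (\<open>l_map_locally_factors\<close>, \<open>locally_cartesian_lift\<close>). The arrows \<open>h\<close> into \<open>d'\<close> for which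
  \<open>f h\<close> factors through some \<open>u\<^sub>i\<close> form a sieve, so by the local character of a topology
  (\<open>cover_local\<close>) this sieve covers \<open>d'\<close>; it is the required family.

  To use \<open>f w\<close> as a test arrow, its image must be an arrow of the comma category: representable
  presheaves must have sheaves as their sheafifications (\<open>plus_sheaf\<close>), and the square formed with
  \<open>eta\<close> must commute (\<open>eta_natural\<close>). Here too the point is that the unit of the plus construction is
  locally injective and locally surjective. In particular, equations between morphisms out of a
  sheafification never touch the classes of matching families: two morphisms into a separated
  presheaf agree as soon as they agree along a locally surjective morphism.
\<close>

section \<open>Covering sieves\<close>

context category
begin

lemma comp_arr [simp]:
  assumes "f \<in> Arr C" "g \<in> Arr C" "Cod C g = Dom C f"
  shows "f \<cdot> g \<in> Arr C" "Dom C (f \<cdot> g) = Dom C g" "Cod C (f \<cdot> g) = Cod C f"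
  using comp_hom[of g "Dom C g" "Dom C f" f "Cod C f"] assms by (auto simp: hom_def)

lemma comp_assoc_arr:
  assumes "f \<in> Arr C" "g \<in> Arr C" "h \<in> Arr C" "Cod C f = Dom C g" "Cod C g = Dom C h"
  shows "(h \<cdot> g) \<cdot> f = h \<cdot> (g \<cdot> f)"
  using comp_assoc[of f "Dom C f" "Dom C g" g "Dom C h" h "Cod C h"] assms by (auto simp: hom_def)

lemma ident_arr [simp]:
  assumes "x \<in> Obj C"
  shows "Ident C x \<in> Arr C" "Dom C (Ident C x) = x" "Cod C (Ident C x) = x"
  using ident_hom[OF assms] by (auto simp: hom_def)

lemma ident_comp [simp]: "f \<in> Arr C \<Longrightarrow> Cod C f = y \<Longrightarrow> Ident C y \<cdot> f = f"
  using ident_left[of f "Dom C f" y] by (auto simp: hom_def)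

lemma comp_ident [simp]: "f \<in> Arr C \<Longrightarrow> Dom C f = x \<Longrightarrow> f \<cdot> Ident C x = f"
  using ident_right[of f x "Cod C f"] by (auto simp: hom_def)

lemma generated_sieve_of_sieve:
  assumes "sieve C c T"
  shows "generated_sieve C T = T"
proof
  show "generated_sieve C T \<subseteq> T"
    using assms by (auto simp: generated_sieve_def sieve_def)
  show "T \<subseteq> generated_sieve C T"
  proof
    fix h assume h: "h \<in> T"
    then have "h \<in> Arr C" using assms by (auto simp: sieve_def)
    then have "h = h \<cdot> Ident C (Dom C h)" "Ident C (Dom C h) \<in> Arr C"
      "Cod C (Ident C (Dom C h)) = Dom C h"
      by (simp_all add: dom_obj)
    then show "h \<in> generated_sieve C T" using h unfolding generated_sieve_def by blast
  qed
qed

end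

context site
begin

lemma cover_arr:
  assumes "c \<in> Obj C" "S \<in> J c" "f \<in> S"
  shows "f \<in> Arr C" "Cod C f = c" "Dom C f \<in> Obj C"
  using covering_sieve[OF assms(1,2)] assms(3) dom_obj by (auto simp: sieve_def)

lemma cover_comp:
  assumes "c \<in> Obj C" "S \<in> J c" "f \<in> S" "g \<in> Arr C" "Cod C g = Dom C f"
  shows "f \<cdot> g \<in> S"
  using covering_sieve[OF assms(1,2)] assms(3-) by (auto simp: sieve_def)

lemma cover_superset:
  assumes "c \<in> Obj C" "S \<in> J c" "sieve C c R" "S \<subseteq> R"
  shows "R \<in> J c"
proof (rule transitivity[OF assms(1,2,3)])
  fix f assume f: "f \<in> S"
  note fa = cover_arr[OF assms(1,2) f]
  have "pullback_sieve C f R = {g \<in> Arr C. Cod C g = Dom C f}"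
    using assms(4) cover_comp[OF assms(1,2) f] by (auto simp: pullback_sieve_def)
  then show "pullback_sieve C f R \<in> J (Dom C f)" using maximal[OF fa(3)] by simp
qed

text \<open>
  Local character of a topology, in the form used throughout: membership of a sieve in the
  topology may be tested after restriction along the arrows of a covering sieve.
\<close>

lemma cover_local:
  assumes c: "c \<in> Obj C" and T: "sieve C c T" and R: "R \<in> J c"
    and loc: "\<And>f. f \<in> R \<Longrightarrow> \<exists>R' \<in> J (Dom C f). \<forall>g \<in> R'. f \<cdot> g \<in> T"
  shows "T \<in> J c"
proof (rule transitivity[OF c R T])
  fix f assume f: "f \<in> R"
  note fa = cover_arr[OF c R f]
  obtain R' where R': "R' \<in> J (Dom C f)" "\<forall>g \<in> R'. f \<cdot> g \<in> T" using loc[OF f] by blast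
  show "pullback_sieve C f T \<in> J (Dom C f)"
  proof (rule cover_superset[OF fa(3) R'(1)])
    show "sieve C (Dom C f) (pullback_sieve C f T)"
      using T fa by (auto simp: sieve_def pullback_sieve_def comp_assoc_arr[symmetric])
    show "R' \<subseteq> pullback_sieve C f T"
      using R' cover_arr[OF fa(3) R'(1)] by (auto simp: pullback_sieve_def)
  qed
qed

lemma cover_inter:
  assumes c: "c \<in> Obj C" and S: "S \<in> J c" and T: "T \<in> J c"
  shows "S \<inter> T \<in> J c"
proof (rule cover_local[OF c _ S])
  show "sieve C c (S \<inter> T)"
    using covering_sieve[OF c S] covering_sieve[OF c T] by (auto simp: sieve_def)
  fix f assume f: "f \<in> S"
  note fa = cover_arr[OF c S f]
  have "pullback_sieve C f T \<in> J (Dom C f)" using stability[OF fa(1)] T fa by simp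
  then show "\<exists>R' \<in> J (Dom C f). \<forall>g \<in> R'. f \<cdot> g \<in> S \<inter> T"
    using cover_comp[OF c S f]
    by (intro bexI[of _ "pullback_sieve C f T"]) (auto simp: pullback_sieve_def)
qed

end


section \<open>Morphisms of presheaves\<close>

lemma presheaf_res:
  assumes "is_presheaf C F" "f \<in> Arr C" "x \<in> Sec F (Cod C f)"
  shows "Res F f x \<in> Sec F (Dom C f)"
  using assms by (auto simp: is_presheaf_def)

lemma presheaf_ident:
  assumes "is_presheaf C F" "c \<in> Obj C" "x \<in> Sec F c"
  shows "Res F (Ident C c) x = x"
  using assms by (auto simp: is_presheaf_def)

lemma presheaf_comp:
  assumes "is_presheaf C F" "f \<in> Arr C" "g \<in> Arr C" "Cod C g = Dom C f" "x \<in> Sec F (Cod C f)"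
  shows "Res F (Comp C f g) x = Res F g (Res F f x)"
  using assms by (auto simp: is_presheaf_def)

lemma psh_hom_val:
  assumes "\<alpha> \<in> psh_hom C F G" "c \<in> Obj C" "x \<in> Sec F c"
  shows "\<alpha> c x \<in> Sec G c"
  using assms by (fastforce simp: psh_hom_def PiE_iff)

lemma psh_hom_nat:
  assumes "\<alpha> \<in> psh_hom C F G" "f \<in> Arr C" "x \<in> Sec F (Cod C f)"
  shows "\<alpha> (Dom C f) (Res F f x) = Res G f (\<alpha> (Cod C f) x)"
  using assms by (auto simp: psh_hom_def)

lemma psh_homI:
  assumes "\<And>c x. c \<in> Obj C \<Longrightarrow> x \<in> Sec F c \<Longrightarrow> \<alpha> c x \<in> Sec G c"
    and "\<And>f x. f \<in> Arr C \<Longrightarrow> Dom C f \<in> Obj C \<Longrightarrow> Cod C f \<in> Obj C \<Longrightarrow> x \<in> Sec F (Cod C f) \<Longrightarrow>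
      \<alpha> (Dom C f) (Res F f x) = Res G f (\<alpha> (Cod C f) x)"
    and "category C" "is_presheaf C F"
  shows "(\<lambda>c \<in> Obj C. \<lambda>x \<in> Sec F c. \<alpha> c x) \<in> psh_hom C F G"
  using assms(1,2) category.dom_obj[OF assms(3)] category.cod_obj[OF assms(3)]
    presheaf_res[OF assms(4)]
  by (auto simp: psh_hom_def)

lemma psh_hom_eqI:
  assumes "\<alpha> \<in> psh_hom C F G" "\<beta> \<in> psh_hom C F G'"
    and "\<And>c x. c \<in> Obj C \<Longrightarrow> x \<in> Sec F c \<Longrightarrow> \<alpha> c x = \<beta> c x"
  shows "\<alpha> = \<beta>"
proof (rule extensionalityI)
  show "\<alpha> \<in> extensional (Obj C)" "\<beta> \<in> extensional (Obj C)"
    using assms(1,2) by (auto simp: psh_hom_def PiE_iff)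
  fix c assume c: "c \<in> Obj C"
  show "\<alpha> c = \<beta> c"
  proof (rule extensionalityI)
    show "\<alpha> c \<in> extensional (Sec F c)" "\<beta> c \<in> extensional (Sec F c)"
      using assms(1,2) c by (auto simp: psh_hom_def PiE_iff)
  qed (use assms(3) c in auto)
qed

lemma psh_comp_hom:
  assumes "category C" "is_presheaf C F" "\<alpha> \<in> psh_hom C F G" "\<beta> \<in> psh_hom C G H"
  shows "psh_comp C F \<beta> \<alpha> \<in> psh_hom C F H"
  unfolding psh_comp_def
  by (rule psh_homI)
    (simp_all add: assms(1,2) psh_hom_val[OF assms(3)] psh_hom_val[OF assms(4)]
      psh_hom_nat[OF assms(3)] psh_hom_nat[OF assms(4)])

lemma psh_comp_apply:
  "c \<in> Obj C \<Longrightarrow> x \<in> Sec F c \<Longrightarrow> psh_comp C F \<beta> \<alpha> c x = \<beta> c (\<alpha> c x)"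
  by (simp add: psh_comp_def)

text \<open>
  The unit of the plus construction is locally injective and locally surjective, and its target is
  separated. These three properties, which are stable under iteration of the construction, then
  replace computations with classes of matching families.
\<close>

definition separated ::
  "('o, 'a) cat \<Rightarrow> ('o \<Rightarrow> 'a set set) \<Rightarrow> ('o, 'a, 'x) presheaf \<Rightarrow> bool" where
  "separated C J F \<longleftrightarrow> (\<forall>c \<in> Obj C. \<forall>x \<in> Sec F c. \<forall>y \<in> Sec F c.
    (\<exists>R \<in> J c. \<forall>f \<in> R. Res F f x = Res F f y) \<longrightarrow> x = y)"

definition locally_injective ::
  "('o, 'a) cat \<Rightarrow> ('o \<Rightarrow> 'a set set) \<Rightarrow> ('o, 'a, 'x) presheaf \<Rightarrow> ('o \<Rightarrow> 'x \<Rightarrow> 'y) \<Rightarrow> bool" where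
  "locally_injective C J F \<alpha> \<longleftrightarrow> (\<forall>c \<in> Obj C. \<forall>x \<in> Sec F c. \<forall>y \<in> Sec F c.
    \<alpha> c x = \<alpha> c y \<longrightarrow> (\<exists>R \<in> J c. \<forall>f \<in> R. Res F f x = Res F f y))"

definition locally_surjective ::
  "('o, 'a) cat \<Rightarrow> ('o \<Rightarrow> 'a set set) \<Rightarrow> ('o, 'a, 'x) presheaf \<Rightarrow> ('o, 'a, 'y) presheaf \<Rightarrow>
    ('o \<Rightarrow> 'x \<Rightarrow> 'y) \<Rightarrow> bool" where
  "locally_surjective C J F G \<alpha> \<longleftrightarrow> (\<forall>c \<in> Obj C. \<forall>y \<in> Sec G c.
    \<exists>R \<in> J c. \<forall>f \<in> R. \<exists>x \<in> Sec F (Dom C f). Res G f y = \<alpha> (Dom C f) x)"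

context site
begin

text \<open>
  A section of \<open>G\<close> is locally in the image of \<open>\<alpha>\<close>, so naturality makes \<open>\<beta>\<close> and \<open>\<gamma>\<close> agree on it
  locally, and separatedness of the target makes them equal. With \<open>\<alpha>\<close> the unit of a
  sheafification, this gives functoriality and naturality of sheafification.
\<close>

lemma hom_eq_if_eq_on_locally_surjective:
  assumes surj: "locally_surjective C J F G \<alpha>"
    and \<beta>: "\<beta> \<in> psh_hom C G H" and \<gamma>: "\<gamma> \<in> psh_hom C G H" and H: "separated C J H"
    and eq: "\<And>c x. c \<in> Obj C \<Longrightarrow> x \<in> Sec F c \<Longrightarrow> \<beta> c (\<alpha> c x) = \<gamma> c (\<alpha> c x)"
  shows "\<beta> = \<gamma>"
proof (rule psh_hom_eqI[OF \<beta> \<gamma>])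
  fix c y assume c: "c \<in> Obj C" and y: "y \<in> Sec G c"
  obtain R where R: "R \<in> J c" and
    loc: "\<And>f. f \<in> R \<Longrightarrow> \<exists>x \<in> Sec F (Dom C f). Res G f y = \<alpha> (Dom C f) x"
    using surj c y unfolding locally_surjective_def by blast
  have "Res H f (\<beta> c y) = Res H f (\<gamma> c y)" if f: "f \<in> R" for f
    using psh_hom_nat[OF \<beta>, of f y] psh_hom_nat[OF \<gamma>, of f y] loc[OF f] eq
      cover_arr[OF c R f] y by auto
  then show "\<beta> c y = \<gamma> c y"
    using H c R psh_hom_val[OF \<beta> c y] psh_hom_val[OF \<gamma> c y] unfolding separated_def by blast
qed

lemma locally_surjective_comp:
  assumes \<alpha>: "locally_surjective C J F G \<alpha>" and \<beta>: "locally_surjective C J G H \<beta>"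
    and F: "is_presheaf C F" and H: "is_presheaf C H"
    and \<alpha>hom: "\<alpha> \<in> psh_hom C F G" and \<beta>hom: "\<beta> \<in> psh_hom C G H"
  shows "locally_surjective C J F H (psh_comp C F \<beta> \<alpha>)"
  unfolding locally_surjective_def
proof (intro ballI)
  fix c z assume c: "c \<in> Obj C" and z: "z \<in> Sec H c"
  let ?lifts = "\<lambda>f. \<exists>x \<in> Sec F (Dom C f). Res H f z = psh_comp C F \<beta> \<alpha> (Dom C f) x"
  let ?T = "{f \<in> Arr C. Cod C f = c \<and> ?lifts f}"
  have hom: "psh_comp C F \<beta> \<alpha> \<in> psh_hom C F H"
    using psh_comp_hom[OF category_axioms F \<alpha>hom \<beta>hom] .
  have "?T \<in> J c"
  proof -
    have sieve: "sieve C c ?T"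
      unfolding sieve_def
    proof (intro conjI ballI impI)
      fix f g assume f: "f \<in> ?T" and g: "g \<in> Arr C" "Cod C g = Dom C f"
      then obtain x where x: "x \<in> Sec F (Dom C f)" "Res H f z = psh_comp C F \<beta> \<alpha> (Dom C f) x"
        by blast
      have "Res H (f \<cdot> g) z = psh_comp C F \<beta> \<alpha> (Dom C g) (Res F g x)"
        using psh_hom_nat[OF hom, of g x] presheaf_comp[OF H, of f g z] f g x z by simp
      moreover have "Res F g x \<in> Sec F (Dom C g)"
        using presheaf_res[OF F, of g x] g x by simp
      ultimately show "f \<cdot> g \<in> ?T" using f g by auto
    qed auto
    obtain R where R: "R \<in> J c" and
      lift: "\<And>f. f \<in> R \<Longrightarrow> \<exists>y \<in> Sec G (Dom C f). Res H f z = \<beta> (Dom C f) y"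
      using \<beta> c z unfolding locally_surjective_def by blast
    show ?thesis
    proof (rule cover_local[OF c sieve R])
      fix f assume f: "f \<in> R"
      note fa = cover_arr[OF c R f]
      obtain y where y: "y \<in> Sec G (Dom C f)" "Res H f z = \<beta> (Dom C f) y" using lift[OF f] by blast
      obtain R' where R': "R' \<in> J (Dom C f)" and
        lift': "\<And>g. g \<in> R' \<Longrightarrow> \<exists>x \<in> Sec F (Dom C g). Res G g y = \<alpha> (Dom C g) x"
        using \<alpha> fa(3) y(1) unfolding locally_surjective_def by blast
      have "f \<cdot> g \<in> ?T" if g: "g \<in> R'" for g
      proof -
        note ga = cover_arr[OF fa(3) R' g]
        obtain x where x: "x \<in> Sec F (Dom C g)" "Res G g y = \<alpha> (Dom C g) x" using lift'[OF g] by blast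
        have "Res H (f \<cdot> g) z = psh_comp C F \<beta> \<alpha> (Dom C g) x"
          using presheaf_comp[OF H, of f g z] psh_hom_nat[OF \<beta>hom, of g y] fa ga x y z
          by (simp add: psh_comp_apply)
        then show ?thesis using fa ga x(1) by auto
      qed
      then show "\<exists>R' \<in> J (Dom C f). \<forall>g \<in> R'. f \<cdot> g \<in> ?T" using R' by blast
    qed
  qed
  then show "\<exists>R \<in> J c. \<forall>f \<in> R. ?lifts f" by (intro bexI[of _ ?T]) auto
qed

text \<open>
  Where two sections agree is the sieve to which the local character is applied in proofs of
  local injectivity.
\<close>

lemma equalizer_sieve:
  assumes F: "is_presheaf C F" and "x \<in> Sec F c" "y \<in> Sec F c"
  shows "sieve C c {f \<in> Arr C. Cod C f = c \<and> Res F f x = Res F f y}"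
  using assms by (auto simp: sieve_def presheaf_comp[OF F])

lemma locally_injective_comp:
  assumes \<alpha>: "locally_injective C J F \<alpha>" and \<beta>: "locally_injective C J G \<beta>"
    and F: "is_presheaf C F" and \<alpha>hom: "\<alpha> \<in> psh_hom C F G"
  shows "locally_injective C J F (psh_comp C F \<beta> \<alpha>)"
  unfolding locally_injective_def
proof (intro ballI impI)
  fix c x y assume c: "c \<in> Obj C" and x: "x \<in> Sec F c" and y: "y \<in> Sec F c"
    and eq: "psh_comp C F \<beta> \<alpha> c x = psh_comp C F \<beta> \<alpha> c y"
  let ?T = "{f \<in> Arr C. Cod C f = c \<and> Res F f x = Res F f y}"
  have "\<beta> c (\<alpha> c x) = \<beta> c (\<alpha> c y)" using eq c x y by (simp add: psh_comp_apply)
  then obtain R where R: "R \<in> J c" and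
    eqR: "\<And>f. f \<in> R \<Longrightarrow> Res G f (\<alpha> c x) = Res G f (\<alpha> c y)"
    using \<beta> c psh_hom_val[OF \<alpha>hom c x] psh_hom_val[OF \<alpha>hom c y]
    unfolding locally_injective_def by blast
  have "?T \<in> J c"
  proof (rule cover_local[OF c equalizer_sieve[OF F x y] R])
    fix f assume f: "f \<in> R"
    note fa = cover_arr[OF c R f]
    have xy: "Res F f x \<in> Sec F (Dom C f)" "Res F f y \<in> Sec F (Dom C f)"
      using presheaf_res[OF F fa(1)] fa x y by auto
    have "\<alpha> (Dom C f) (Res F f x) = \<alpha> (Dom C f) (Res F f y)"
      using psh_hom_nat[OF \<alpha>hom fa(1)] fa x y eqR[OF f] by simp
    then obtain R' where R': "R' \<in> J (Dom C f)"
      "\<forall>g \<in> R'. Res F g (Res F f x) = Res F g (Res F f y)"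
      using \<alpha> fa(3) xy unfolding locally_injective_def by blast
    then show "\<exists>R' \<in> J (Dom C f). \<forall>g \<in> R'. f \<cdot> g \<in> ?T"
      using cover_arr[OF fa(3) R'(1)] fa x y
      by (intro bexI[of _ R']) (auto simp: presheaf_comp[OF F])
  qed
  then show "\<exists>R \<in> J c. \<forall>f \<in> R. Res F f x = Res F f y" by (intro bexI[of _ ?T]) auto
qed

end


section \<open>The plus construction\<close>

context site
begin

definition fams :: "('o, 'a, 'x) presheaf \<Rightarrow> 'o \<Rightarrow> ('a \<rightharpoonup> 'x) set" where
  "fams F c = {m. dom m \<in> J c \<and> matching_family C F m}"

definition principal_family :: "('o, 'a, 'x) presheaf \<Rightarrow> 'o \<Rightarrow> 'x \<Rightarrow> ('a \<rightharpoonup> 'x)" where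
  "principal_family F c x = (\<lambda>f. if f \<in> Arr C \<and> Cod C f = c then Some (Res F f x) else None)"

lemma Sec_plus: "Sec (plus_psh C J F) c = fams F c // match_rel C J F c"
  by (simp add: plus_psh_def fams_def)

lemma match_rel_iff:
  "(m, m') \<in> match_rel C J F c \<longleftrightarrow> m \<in> fams F c \<and> m' \<in> fams F c \<and>
    (\<exists>R \<in> J c. R \<subseteq> dom m \<inter> dom m' \<and> (\<forall>f \<in> R. m f = m' f))"
  by (auto simp: match_rel_def fams_def)

lemma equiv_match_rel:
  assumes c: "c \<in> Obj C"
  shows "equiv (fams F c) (match_rel C J F c)"
proof (rule equivI)
  show "match_rel C J F c \<subseteq> fams F c \<times> fams F c" by (auto simp: match_rel_iff)
  show "refl_on (fams F c) (match_rel C J F c)"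
    by (auto simp: refl_on_def match_rel_iff fams_def)
  show "sym (match_rel C J F c)"
    by (rule symI) (metis match_rel_iff inf_commute)
  show "trans (match_rel C J F c)"
  proof (rule transI)
    fix l m n assume "(l, m) \<in> match_rel C J F c" "(m, n) \<in> match_rel C J F c"
    then obtain R S where "R \<in> J c" "S \<in> J c" "R \<subseteq> dom l \<inter> dom m" "\<forall>f \<in> R. l f = m f"
      "S \<subseteq> dom m \<inter> dom n" "\<forall>f \<in> S. m f = n f" and "l \<in> fams F c" "n \<in> fams F c"
      by (auto simp: match_rel_iff)
    then show "(l, n) \<in> match_rel C J F c"
      unfolding match_rel_iff using cover_inter[OF c, of R S]
      by (intro conjI bexI[of _ "R \<inter> S"]) auto
  qed
qed

lemma class_eq_iff:
  assumes "c \<in> Obj C" "m \<in> fams F c" "m' \<in> fams F c"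
  shows "match_rel C J F c `` {m} = match_rel C J F c `` {m'} \<longleftrightarrow> (m, m') \<in> match_rel C J F c"
  using eq_equiv_class_iff[OF equiv_match_rel] assms by blast

text \<open>
  An operation \<open>\<phi>\<close> that respects the relation sends a class to a set that need not be a class, but
  whose saturation is the class of \<open>\<phi> m\<close>. Restriction and functoriality of the plus construction
  are of this form and can so be computed on a representative.
\<close>

lemma image_class:
  assumes c: "c' \<in> Obj C" and m: "m \<in> fams F c" "c \<in> Obj C"
    and resp: "\<And>m'. (m, m') \<in> match_rel C J F c \<Longrightarrow> (\<phi> m, \<phi> m') \<in> match_rel C J G c'"
  shows "match_rel C J G c' `` (\<phi> ` (match_rel C J F c `` {m})) = match_rel C J G c' `` {\<phi> m}"
proof -
  have "(m, m) \<in> match_rel C J F c"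
    using equiv_match_rel[OF m(2)] m(1) by (auto simp: equiv_def refl_on_def)
  moreover have "match_rel C J G c' `` {\<phi> m'} = match_rel C J G c' `` {\<phi> m}"
    if "(m, m') \<in> match_rel C J F c" for m'
    using equiv_class_eq[OF equiv_match_rel[OF c] resp[OF that]] by simp
  ultimately show ?thesis by blast
qed

lemma fams_dom:
  assumes "c \<in> Obj C" "m \<in> fams F c" "f \<in> dom m"
  shows "f \<in> Arr C" "Cod C f = c" "Dom C f \<in> Obj C" "the (m f) \<in> Sec F (Dom C f)"
  using cover_arr[OF assms(1) _ assms(3)] assms(2,3)
  by (auto simp: fams_def matching_family_def)

lemma fams_comp:
  assumes "m \<in> fams F c" "f \<in> dom m" "g \<in> Arr C" "Cod C g = Dom C f"
  shows "m (f \<cdot> g) = Some (Res F g (the (m f)))"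
  using assms by (auto simp: fams_def matching_family_def)

lemma principal_family_fams:
  assumes "is_presheaf C F" "c \<in> Obj C" "x \<in> Sec F c"
  shows "principal_family F c x \<in> fams F c"
proof -
  have "dom (principal_family F c x) = {f \<in> Arr C. Cod C f = c}"
    by (auto simp: principal_family_def split: if_splits)
  then show ?thesis
    using assms maximal[OF assms(2)]
    by (auto simp: fams_def matching_family_def principal_family_def
        presheaf_comp[OF assms(1)] intro: presheaf_res[OF assms(1)] split: if_splits)
qed

lemma dom_restrict_family: "dom (restrict_family C g m) = pullback_sieve C g (dom m)"
  by (auto simp: restrict_family_def pullback_sieve_def split: if_splits)

lemma restrict_family_fams:
  assumes g: "g \<in> Arr C" and m: "m \<in> fams F (Cod C g)"
  shows "restrict_family C g m \<in> fams F (Dom C g)"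
proof -
  note doms = fams_dom[OF cod_obj[OF g] m] and comps = fams_comp[OF m]
  have "dom (restrict_family C g m) \<in> J (Dom C g)"
    unfolding dom_restrict_family using stability[OF g] m by (simp add: fams_def)
  moreover have "matching_family C F (restrict_family C g m)"
    unfolding matching_family_def
  proof (intro ballI conjI impI)
    fix f assume "f \<in> dom (restrict_family C g m)"
    then have f: "f \<in> Arr C" "Cod C f = Dom C g" "g \<cdot> f \<in> dom m"
      by (auto simp: dom_restrict_family pullback_sieve_def)
    then show "the (restrict_family C g m f) \<in> Sec F (Dom C f)"
      using doms(4)[OF f(3)] g by (simp add: restrict_family_def)
    fix h assume h: "h \<in> Arr C" "Cod C h = Dom C f"
    then show "restrict_family C g m (f \<cdot> h) = Some (Res F h (the (restrict_family C g m f)))"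
      using f g comps[OF f(3), of h] by (simp add: restrict_family_def comp_assoc_arr)
  qed
  ultimately show ?thesis by (simp add: fams_def)
qed

lemma restrict_family_rel:
  assumes g: "g \<in> Arr C" and rel: "(m, m') \<in> match_rel C J F (Cod C g)"
  shows "(restrict_family C g m, restrict_family C g m') \<in> match_rel C J F (Dom C g)"
proof -
  obtain R where R: "R \<in> J (Cod C g)" "R \<subseteq> dom m \<inter> dom m'" "\<forall>f \<in> R. m f = m' f"
    and m: "m \<in> fams F (Cod C g)" "m' \<in> fams F (Cod C g)"
    using rel by (auto simp: match_rel_iff)
  have "\<forall>f \<in> pullback_sieve C g R. restrict_family C g m f = restrict_family C g m' f"
    using R(3) by (auto simp: restrict_family_def pullback_sieve_def)
  moreover have "pullback_sieve C g R \<subseteq> dom (restrict_family C g m) \<inter> dom (restrict_family C g m')"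
    unfolding dom_restrict_family using R(2) by (auto simp: pullback_sieve_def)
  ultimately show ?thesis
    unfolding match_rel_iff using stability[OF g R(1)] restrict_family_fams[OF g] m by blast
qed

lemma Res_plus_class:
  assumes g: "g \<in> Arr C" and m: "m \<in> fams F (Cod C g)"
  shows "Res (plus_psh C J F) g (match_rel C J F (Cod C g) `` {m})
    = match_rel C J F (Dom C g) `` {restrict_family C g m}"
  using image_class[where \<phi> = "restrict_family C g" and F = F and G = F,
      OF dom_obj[OF g] m cod_obj[OF g] restrict_family_rel[OF g]]
  by (simp add: plus_psh_def)

lemma class_in_Sec_plus: "m \<in> fams F c \<Longrightarrow> match_rel C J F c `` {m} \<in> Sec (plus_psh C J F) c"
  by (simp add: Sec_plus quotientI)

lemma Sec_plusE:
  assumes "X \<in> Sec (plus_psh C J F) c"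
  obtains m where "m \<in> fams F c" "X = match_rel C J F c `` {m}"
  using assms by (auto simp: Sec_plus elim: quotientE)

lemma plus_presheaf: "is_presheaf C (plus_psh C J F)"
  unfolding is_presheaf_def
proof (intro conjI ballI impI funcsetI)
  fix f X assume f: "f \<in> Arr C" and "X \<in> Sec (plus_psh C J F) (Cod C f)"
  then show "Res (plus_psh C J F) f X \<in> Sec (plus_psh C J F) (Dom C f)"
    by (elim Sec_plusE) (simp add: Res_plus_class class_in_Sec_plus restrict_family_fams)
next
  fix c X assume c: "c \<in> Obj C" and "X \<in> Sec (plus_psh C J F) c"
  then obtain m where m: "m \<in> fams F c" "X = match_rel C J F c `` {m}" by (elim Sec_plusE)
  have "restrict_family C (Ident C c) m = m"
  proof
    fix f
    show "restrict_family C (Ident C c) m f = m f"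
      using fams_dom[OF c m(1), of f] c by (cases "m f") (auto simp: restrict_family_def domIff)
  qed
  then show "Res (plus_psh C J F) (Ident C c) X = X"
    using Res_plus_class[of "Ident C c" m F] c m by simp
next
  fix f g X assume fg: "f \<in> Arr C" "g \<in> Arr C" "Cod C g = Dom C f"
    and "X \<in> Sec (plus_psh C J F) (Cod C f)"
  then obtain m where m: "m \<in> fams F (Cod C f)" "X = match_rel C J F (Cod C f) `` {m}"
    by (elim Sec_plusE)
  have "restrict_family C (f \<cdot> g) m = restrict_family C g (restrict_family C f m)"
    using fg by (auto simp: restrict_family_def comp_assoc_arr)
  then show "Res (plus_psh C J F) (f \<cdot> g) X = Res (plus_psh C J F) g (Res (plus_psh C J F) f X)"
    using fg m Res_plus_class[of f m F] Res_plus_class[of "f \<cdot> g" m F]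
      Res_plus_class[of g "restrict_family C f m" F] restrict_family_fams[of f m F] by simp
qed

lemma plus_unit_class:
  assumes "c \<in> Obj C" "x \<in> Sec F c"
  shows "plus_unit C J F c x = match_rel C J F c `` {principal_family F c x}"
  using assms by (simp add: plus_unit_def principal_family_def)

lemma restrict_principal_family:
  assumes "is_presheaf C F" "f \<in> Arr C" "x \<in> Sec F (Cod C f)"
  shows "restrict_family C f (principal_family F (Cod C f) x)
    = principal_family F (Dom C f) (Res F f x)"
  using assms
  by (auto simp: restrict_family_def principal_family_def presheaf_comp[OF assms(1)])

lemma plus_unit_hom:
  assumes F: "is_presheaf C F"
  shows "plus_unit C J F \<in> psh_hom C F (plus_psh C J F)"
proof -
  have "(\<lambda>c \<in> Obj C. \<lambda>x \<in> Sec F c. plus_unit C J F c x) \<in> psh_hom C F (plus_psh C J F)"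
  proof (rule psh_homI[OF _ _ category_axioms F])
    fix c x assume "c \<in> Obj C" "x \<in> Sec F c"
    then show "plus_unit C J F c x \<in> Sec (plus_psh C J F) c"
      by (simp add: plus_unit_class class_in_Sec_plus principal_family_fams[OF F])
  next
    fix f x assume f: "f \<in> Arr C" "Dom C f \<in> Obj C" "Cod C f \<in> Obj C" and x: "x \<in> Sec F (Cod C f)"
    then show "plus_unit C J F (Dom C f) (Res F f x)
        = Res (plus_psh C J F) f (plus_unit C J F (Cod C f) x)"
      by (simp add: plus_unit_class presheaf_res[OF F] Res_plus_class principal_family_fams[OF F]
          restrict_principal_family[OF F])
  qed
  moreover have "(\<lambda>c \<in> Obj C. \<lambda>x \<in> Sec F c. plus_unit C J F c x) = plus_unit C J F"
    by (auto simp: plus_unit_def restrict_def fun_eq_iff)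
  ultimately show ?thesis by simp
qed

lemma plus_unit_eq_iff:
  assumes F: "is_presheaf C F" and c: "c \<in> Obj C" and x: "x \<in> Sec F c" and y: "y \<in> Sec F c"
  shows "plus_unit C J F c x = plus_unit C J F c y \<longleftrightarrow>
    (\<exists>R \<in> J c. \<forall>f \<in> R. Res F f x = Res F f y)"
proof -
  have "plus_unit C J F c x = plus_unit C J F c y \<longleftrightarrow>
    (\<exists>R \<in> J c. R \<subseteq> dom (principal_family F c x) \<inter> dom (principal_family F c y) \<and>
      (\<forall>f \<in> R. principal_family F c x f = principal_family F c y f))"
    using assms by (simp add: plus_unit_class class_eq_iff principal_family_fams match_rel_iff)
  also have "\<dots> \<longleftrightarrow> (\<exists>R \<in> J c. \<forall>f \<in> R. Res F f x = Res F f y)"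
  proof (rule bex_cong[OF refl])
    fix R assume R: "R \<in> J c"
    have "f \<in> Arr C \<and> Cod C f = c" if "f \<in> R" for f using cover_arr[OF c R that] by simp
    then show "(R \<subseteq> dom (principal_family F c x) \<inter> dom (principal_family F c y) \<and>
      (\<forall>f \<in> R. principal_family F c x f = principal_family F c y f)) \<longleftrightarrow>
      (\<forall>f \<in> R. Res F f x = Res F f y)"
      by (auto simp: principal_family_def)
  qed
  finally show ?thesis .
qed

lemma plus_unit_locally_injective:
  "is_presheaf C F \<Longrightarrow> locally_injective C J F (plus_unit C J F)"
  by (simp add: locally_injective_def plus_unit_eq_iff)

text \<open>
  By the matching condition, restricting \<open>m\<close> along \<open>f\<close> in its domain gives exactly the family of all
  restrictions of the section \<open>m f\<close>. So the class of \<open>m\<close> amalgamates \<open>m\<close>, and every section of the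
  plus construction comes locally from \<open>F\<close>.
\<close>

lemma Res_plus_class_dom:
  assumes c: "c \<in> Obj C" and m: "m \<in> fams F c" and f: "f \<in> dom m"
  shows "Res (plus_psh C J F) f (match_rel C J F c `` {m}) = plus_unit C J F (Dom C f) (the (m f))"
proof -
  note fa = fams_dom[OF c m f]
  have "restrict_family C f m = principal_family F (Dom C f) (the (m f))"
    using fams_comp[OF m f] by (auto simp: restrict_family_def principal_family_def)
  then show ?thesis using Res_plus_class[of f m F] fa m by (simp add: plus_unit_class)
qed

lemma plus_unit_locally_surjective:
  "locally_surjective C J F (plus_psh C J F) (plus_unit C J F)"
  unfolding locally_surjective_def
proof (intro ballI)
  fix c X assume c: "c \<in> Obj C" and "X \<in> Sec (plus_psh C J F) c"
  then obtain m where m: "m \<in> fams F c" "X = match_rel C J F c `` {m}" by (elim Sec_plusE)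
  then have "dom m \<in> J c" by (simp add: fams_def)
  then show "\<exists>R \<in> J c. \<forall>f \<in> R. \<exists>x \<in> Sec F (Dom C f).
      Res (plus_psh C J F) f X = plus_unit C J F (Dom C f) x"
    using Res_plus_class_dom[OF c m(1)] fams_dom(4)[OF c m(1)] m(2) by blast
qed

text \<open>
  If two classes agree locally, then by local injectivity of the unit their representatives agree
  after one more restriction, hence on a covering sieve.
\<close>

lemma plus_separated:
  assumes F: "is_presheaf C F"
  shows "separated C J (plus_psh C J F)"
  unfolding separated_def
proof (intro ballI impI)
  fix c X Y assume c: "c \<in> Obj C" and "X \<in> Sec (plus_psh C J F) c" "Y \<in> Sec (plus_psh C J F) c"
    and "\<exists>R \<in> J c. \<forall>f \<in> R. Res (plus_psh C J F) f X = Res (plus_psh C J F) f Y"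
  then obtain m n R where m: "m \<in> fams F c" "X = match_rel C J F c `` {m}"
    and n: "n \<in> fams F c" "Y = match_rel C J F c `` {n}"
    and R: "R \<in> J c" "\<And>f. f \<in> R \<Longrightarrow> Res (plus_psh C J F) f X = Res (plus_psh C J F) f Y"
    by (metis Sec_plusE)
  let ?T = "{f \<in> dom m \<inter> dom n. m f = n f}"
  have cov: "R \<inter> (dom m \<inter> dom n) \<in> J c"
    using m(1) n(1) R(1) by (auto simp: fams_def intro!: cover_inter[OF c])
  have T: "sieve C c ?T"
    unfolding sieve_def
  proof (intro conjI ballI impI)
    show "?T \<subseteq> {f \<in> Arr C. Cod C f = c}" using fams_dom(1,2)[OF c m(1)] by blast
    fix f g assume "f \<in> ?T" "g \<in> Arr C" "Cod C g = Dom C f"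
    then show "f \<cdot> g \<in> ?T"
      using fams_comp[OF m(1), of f g] fams_comp[OF n(1), of f g] by (simp add: domI)
  qed
  have "?T \<in> J c"
  proof (rule cover_local[OF c T cov])
    fix f assume f: "f \<in> R \<inter> (dom m \<inter> dom n)"
    then have fm: "f \<in> dom m" and fn: "f \<in> dom n" and fR: "f \<in> R" by auto
    note fa = fams_dom[OF c m(1) fm]
    have "plus_unit C J F (Dom C f) (the (m f)) = plus_unit C J F (Dom C f) (the (n f))"
      using R(2)[OF fR] m n Res_plus_class_dom[OF c m(1) fm] Res_plus_class_dom[OF c n(1) fn] by simp
    then obtain R' where R': "R' \<in> J (Dom C f)"
      "\<And>g. g \<in> R' \<Longrightarrow> Res F g (the (m f)) = Res F g (the (n f))"
      using plus_unit_eq_iff[OF F fa(3) fa(4) fams_dom(4)[OF c n(1) fn]] by blast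
    have "f \<cdot> g \<in> ?T" if g: "g \<in> R'" for g
      using cover_arr[OF fa(3) R'(1) g] R'(2)[OF g] fams_comp[OF m(1) fm, of g]
        fams_comp[OF n(1) fn, of g] by auto
    then show "\<exists>R' \<in> J (Dom C f). \<forall>g \<in> R'. f \<cdot> g \<in> ?T" using R'(1) by blast
  qed
  then have "(m, n) \<in> match_rel C J F c"
    unfolding match_rel_iff using m n by (intro conjI bexI[of _ ?T]) auto
  then show "X = Y" using class_eq_iff[OF c m(1) n(1)] m n by simp
qed

text \<open>
  For separated \<open>F\<close> the unit is injective, so \<open>F\<close> may be thought of as a subpresheaf of the plus
  construction. Given a matching family \<open>M\<close>, keep only the members that lie in \<open>F\<close>: as the unit is
  locally surjective, they are still indexed by a covering sieve. They form a matching
  family of \<open>F\<close>, and its class is the amalgamation of \<open>M\<close>.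
\<close>

lemma plus_sheaf:
  assumes F: "is_presheaf C F" and sep: "separated C J F"
  shows "is_sheaf C J (plus_psh C J F)"
  unfolding is_sheaf_def
proof (intro conjI ballI allI impI)
  let ?P = "plus_psh C J F" and ?u = "plus_unit C J F"
  show "is_presheaf C ?P" by (rule plus_presheaf)
  fix c M assume c: "c \<in> Obj C" and M: "dom M \<in> J c \<and> matching_family C ?P M"
  have inj: "x = y" if "e \<in> Obj C" "x \<in> Sec F e" "y \<in> Sec F e" "?u e x = ?u e y" for e x y
    using sep[unfolded separated_def, rule_format, OF that(1,2,3)]
      plus_unit_eq_iff[OF F that(1,2,3)] that(4) by simp
  have Mdom: "f \<in> Arr C" "Cod C f = c" "Dom C f \<in> Obj C" "the (M f) \<in> Sec ?P (Dom C f)"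
    if "f \<in> dom M" for f
    using cover_arr[OF c _ that] M that by (auto simp: matching_family_def)
  have Mcomp: "M (f \<cdot> g) = Some (Res ?P g (the (M f)))"
    if "f \<in> dom M" "g \<in> Arr C" "Cod C g = Dom C f" for f g
    using M that by (auto simp: matching_family_def)
  \<comment> \<open>The part of \<open>M\<close> that takes values in \<open>F\<close>; injectivity of the unit makes the choice unique.\<close>
  let ?rep = "\<lambda>f x. x \<in> Sec F (Dom C f) \<and> M f = Some (?u (Dom C f) x)"
  define m where "m = (\<lambda>f. if \<exists>x. ?rep f x then Some (SOME x. ?rep f x) else None)"
  have m_eq: "m f = Some x" if "?rep f x" for f x
  proof -
    have "f \<in> dom M" using that by auto
    then have "y = x" if "?rep f y" for y
      using inj[of "Dom C f" y x] Mdom(3) \<open>?rep f x\<close> that by auto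
    then have "(SOME y. ?rep f y) = x" using that by (intro some_equality)
    then show ?thesis using that by (auto simp: m_def)
  qed
  have m_rep: "?rep f (the (m f))" if "f \<in> dom m" for f
  proof -
    have "\<exists>x. ?rep f x"
    proof (rule ccontr)
      assume "\<nexists>x. ?rep f x"
      then have "m f = None" unfolding m_def by (simp only: if_False)
      then show False using that by blast
    qed
    then obtain x where x: "?rep f x" by blast
    show ?thesis using m_eq[OF x] x by simp
  qed
  have m_comp: "m (f \<cdot> g) = Some (Res F g (the (m f)))"
    if f: "f \<in> dom m" and g: "g \<in> Arr C" "Cod C g = Dom C f" for f g
  proof (rule m_eq)
    note r = m_rep[OF f]
    then have fM: "f \<in> dom M" by auto
    show "?rep (f \<cdot> g) (Res F g (the (m f)))"
      using presheaf_res[OF F g(1)] psh_hom_nat[OF plus_unit_hom[OF F] g(1)] r g Mdom[OF fM]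
        Mcomp[OF fM g] by auto
  qed
  have mM: "dom m \<subseteq> dom M" using m_rep by blast
  have m_sieve: "sieve C c (dom m)"
    unfolding sieve_def
  proof (intro conjI ballI impI)
    show "dom m \<subseteq> {f \<in> Arr C. Cod C f = c}" using mM Mdom(1,2) by blast
    fix f g assume "f \<in> dom m" "g \<in> Arr C" "Cod C g = Dom C f"
    then show "f \<cdot> g \<in> dom m" using m_comp[of f g] by (simp add: domI)
  qed
  have "dom m \<in> J c"
  proof (rule cover_local[OF c m_sieve])
    show "dom M \<in> J c" using M by simp
    fix f assume f: "f \<in> dom M"
    note fa = Mdom[OF f]
    obtain R where R: "R \<in> J (Dom C f)"
      "\<And>g. g \<in> R \<Longrightarrow> \<exists>x \<in> Sec F (Dom C g). Res ?P g (the (M f)) = ?u (Dom C g) x"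
      using plus_unit_locally_surjective[of F, unfolded locally_surjective_def, rule_format,
          OF fa(3,4)] by blast
    have "f \<cdot> g \<in> dom m" if g: "g \<in> R" for g
    proof -
      note ga = cover_arr[OF fa(3) R(1) g]
      obtain x where "x \<in> Sec F (Dom C g)" "Res ?P g (the (M f)) = ?u (Dom C g) x"
        using R(2)[OF g] by blast
      then have "?rep (f \<cdot> g) x" using fa ga Mcomp[OF f] by simp
      then show ?thesis using m_eq by blast
    qed
    then show "\<exists>R \<in> J (Dom C f). \<forall>g \<in> R. f \<cdot> g \<in> dom m" using R(1) by blast
  qed
  moreover have "matching_family C F m"
    unfolding matching_family_def using m_rep m_comp by blast
  ultimately have m: "m \<in> fams F c" by (simp add: fams_def)
  let ?X = "match_rel C J F c `` {m}"
  have X: "?X \<in> Sec ?P c" using class_in_Sec_plus[OF m] .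
  have X_m: "Some (Res ?P h ?X) = M h" if h: "h \<in> dom m" for h
    using m_rep[OF h] Res_plus_class_dom[OF c m h] by simp
  note sepP = plus_separated[OF F, unfolded separated_def, rule_format]
  show "\<exists>!X. X \<in> Sec ?P c \<and> (\<forall>f \<in> dom M. M f = Some (Res ?P f X))"
  proof (rule ex1I[of _ ?X])
    \<comment> \<open>Outside the domain of \<open>m\<close>, agreement is tested after restriction to it.\<close>
    have "M f = Some (Res ?P f ?X)" if f: "f \<in> dom M" for f
    proof -
      note fa = Mdom[OF f]
      have S: "pullback_sieve C f (dom m) \<in> J (Dom C f)"
        using stability[OF fa(1)] \<open>dom m \<in> J c\<close> fa(2) by simp
      have "Res ?P g (the (M f)) = Res ?P g (Res ?P f ?X)" if g: "g \<in> pullback_sieve C f (dom m)" for g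
      proof -
        have ga: "g \<in> Arr C" "Cod C g = Dom C f" "f \<cdot> g \<in> dom m"
          using g by (auto simp: pullback_sieve_def)
        then show ?thesis
          using X_m[OF ga(3)] Mcomp[OF f ga(1,2)] presheaf_comp[OF plus_presheaf, of f g ?X F] X fa
          by simp
      qed
      then have "the (M f) = Res ?P f ?X"
        using S sepP[OF fa(3,4), of "Res ?P f ?X"] presheaf_res[OF plus_presheaf fa(1), of ?X] X fa(2)
        by blast
      then show ?thesis using f by auto
    qed
    then show "?X \<in> Sec ?P c \<and> (\<forall>f \<in> dom M. M f = Some (Res ?P f ?X))" using X by blast
    fix Y assume "Y \<in> Sec ?P c \<and> (\<forall>f \<in> dom M. M f = Some (Res ?P f Y))"
    then show "Y = ?X"
      using sepP[OF c _ X, of Y] \<open>dom m \<in> J c\<close> X_m mM by (metis option.sel subsetD)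
  qed
qed

lemma map_family_fams:
  assumes \<alpha>: "\<alpha> \<in> psh_hom C F G" and c: "c \<in> Obj C" and m: "m \<in> fams F c"
  shows "(\<lambda>f. map_option (\<alpha> (Dom C f)) (m f)) \<in> fams G c"
proof -
  have "dom (\<lambda>f. map_option (\<alpha> (Dom C f)) (m f)) = dom m" by auto
  moreover have "matching_family C G (\<lambda>f. map_option (\<alpha> (Dom C f)) (m f))"
    unfolding matching_family_def
  proof (intro ballI conjI impI)
    fix f assume "f \<in> dom (\<lambda>f. map_option (\<alpha> (Dom C f)) (m f))"
    then have f: "f \<in> dom m" by auto
    then have mf: "map_option (\<alpha> (Dom C f)) (m f) = Some (\<alpha> (Dom C f) (the (m f)))"
      by (cases "m f") auto
    note fa = fams_dom[OF c m f]
    show "the (map_option (\<alpha> (Dom C f)) (m f)) \<in> Sec G (Dom C f)"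
      unfolding mf using psh_hom_val[OF \<alpha> fa(3,4)] by simp
    fix g assume g: "g \<in> Arr C" "Cod C g = Dom C f"
    then show "map_option (\<alpha> (Dom C (f \<cdot> g))) (m (f \<cdot> g))
        = Some (Res G g (the (map_option (\<alpha> (Dom C f)) (m f))))"
      unfolding mf using fams_comp[OF m f g] psh_hom_nat[OF \<alpha> g(1)] fa by simp
  qed
  ultimately show ?thesis using m by (simp add: fams_def)
qed

lemma map_family_rel:
  assumes \<alpha>: "\<alpha> \<in> psh_hom C F G" and c: "c \<in> Obj C" and rel: "(m, m') \<in> match_rel C J F c"
  shows "((\<lambda>f. map_option (\<alpha> (Dom C f)) (m f)), (\<lambda>f. map_option (\<alpha> (Dom C f)) (m' f)))
    \<in> match_rel C J G c"
proof -
  obtain R where R: "R \<in> J c" "R \<subseteq> dom m \<inter> dom m'" "\<forall>f \<in> R. m f = m' f"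
    and m: "m \<in> fams F c" "m' \<in> fams F c"
    using rel by (auto simp: match_rel_iff)
  have "dom (\<lambda>f. map_option (\<alpha> (Dom C f)) (n f)) = dom n" for n :: "'a \<rightharpoonup> 'b" by auto
  then show ?thesis
    unfolding match_rel_iff using R m map_family_fams[OF \<alpha> c]
    by (intro conjI bexI[of _ R]) simp_all
qed

lemma plus_map_class:
  assumes \<alpha>: "\<alpha> \<in> psh_hom C F G" and c: "c \<in> Obj C" and m: "m \<in> fams F c"
  shows "plus_map C J F G \<alpha> c (match_rel C J F c `` {m})
    = match_rel C J G c `` {\<lambda>f. map_option (\<alpha> (Dom C f)) (m f)}"
  using image_class[where \<phi> = "\<lambda>m f. map_option (\<alpha> (Dom C f)) (m f)" and F = F and G = G,
      OF c m c map_family_rel[OF \<alpha> c]] class_in_Sec_plus[OF m] c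
  by (simp add: plus_map_def)

lemma plus_map_hom:
  assumes \<alpha>: "\<alpha> \<in> psh_hom C F G"
  shows "plus_map C J F G \<alpha> \<in> psh_hom C (plus_psh C J F) (plus_psh C J G)"
proof -
  have "(\<lambda>c \<in> Obj C. \<lambda>X \<in> Sec (plus_psh C J F) c. plus_map C J F G \<alpha> c X)
    \<in> psh_hom C (plus_psh C J F) (plus_psh C J G)"
  proof (rule psh_homI[OF _ _ category_axioms plus_presheaf])
    fix c X assume "c \<in> Obj C" "X \<in> Sec (plus_psh C J F) c"
    then show "plus_map C J F G \<alpha> c X \<in> Sec (plus_psh C J G) c"
      by (auto elim!: Sec_plusE simp: plus_map_class[OF \<alpha>] class_in_Sec_plus map_family_fams[OF \<alpha>])
  next
    fix f X assume f: "f \<in> Arr C" "Dom C f \<in> Obj C" "Cod C f \<in> Obj C"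
      and "X \<in> Sec (plus_psh C J F) (Cod C f)"
    then obtain m where m: "m \<in> fams F (Cod C f)" "X = match_rel C J F (Cod C f) `` {m}"
      by (elim Sec_plusE)
    have "restrict_family C f (\<lambda>h. map_option (\<alpha> (Dom C h)) (m h))
      = (\<lambda>h. map_option (\<alpha> (Dom C h)) (restrict_family C f m h))"
      using f by (auto simp: restrict_family_def)
    then show "plus_map C J F G \<alpha> (Dom C f) (Res (plus_psh C J F) f X)
        = Res (plus_psh C J G) f (plus_map C J F G \<alpha> (Cod C f) X)"
      using f m by (simp add: plus_map_class[OF \<alpha>] Res_plus_class map_family_fams[OF \<alpha>]
          restrict_family_fams)
  qed
  moreover have "(\<lambda>c \<in> Obj C. \<lambda>X \<in> Sec (plus_psh C J F) c. plus_map C J F G \<alpha> c X)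
    = plus_map C J F G \<alpha>"
    by (auto simp: plus_map_def restrict_def fun_eq_iff)
  ultimately show ?thesis by simp
qed

lemma plus_map_unit:
  assumes F: "is_presheaf C F" and \<alpha>: "\<alpha> \<in> psh_hom C F G" and c: "c \<in> Obj C" and x: "x \<in> Sec F c"
  shows "plus_map C J F G \<alpha> c (plus_unit C J F c x) = plus_unit C J G c (\<alpha> c x)"
proof -
  have "(\<lambda>f. map_option (\<alpha> (Dom C f)) (principal_family F c x f)) = principal_family G c (\<alpha> c x)"
    using psh_hom_nat[OF \<alpha>] x by (auto simp: principal_family_def)
  then show ?thesis
    using c x by (simp add: plus_unit_class plus_map_class[OF \<alpha>] principal_family_fams[OF F]
        psh_hom_val[OF \<alpha>])
qed

end


section \<open>Sheafification\<close>

context site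
begin

lemma sheafify_presheaf: "is_presheaf C (sheafify C J F)"
  unfolding sheafify_def by (rule plus_presheaf)

lemma sheafify_separated: "separated C J (sheafify C J F)"
  unfolding sheafify_def by (rule plus_separated[OF plus_presheaf])

lemma sheafify_sheaf: "is_presheaf C F \<Longrightarrow> is_sheaf C J (sheafify C J F)"
  unfolding sheafify_def by (rule plus_sheaf[OF plus_presheaf plus_separated])

lemma sheafify_unit_hom:
  "is_presheaf C F \<Longrightarrow> sheafify_unit C J F \<in> psh_hom C F (sheafify C J F)"
  unfolding sheafify_def sheafify_unit_def
  using psh_comp_hom[OF category_axioms _ plus_unit_hom plus_unit_hom[OF plus_presheaf]] by blast

lemma sheafify_unit_locally_injective:
  "is_presheaf C F \<Longrightarrow> locally_injective C J F (sheafify_unit C J F)"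
  unfolding sheafify_unit_def
  using locally_injective_comp[OF plus_unit_locally_injective
      plus_unit_locally_injective[OF plus_presheaf] _ plus_unit_hom] by blast

lemma sheafify_unit_locally_surjective:
  "is_presheaf C F \<Longrightarrow> locally_surjective C J F (sheafify C J F) (sheafify_unit C J F)"
  unfolding sheafify_unit_def sheafify_def
  using locally_surjective_comp[OF plus_unit_locally_surjective plus_unit_locally_surjective _
      plus_presheaf plus_unit_hom plus_unit_hom[OF plus_presheaf]] by blast

lemma sheafify_map_hom:
  "\<alpha> \<in> psh_hom C F G \<Longrightarrow> sheafify_map C J F G \<alpha> \<in> psh_hom C (sheafify C J F) (sheafify C J G)"
  unfolding sheafify_def sheafify_map_def by (intro plus_map_hom)

lemma sheafify_map_unit:
  assumes "is_presheaf C F" "\<alpha> \<in> psh_hom C F G" "c \<in> Obj C" "x \<in> Sec F c"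
  shows "sheafify_map C J F G \<alpha> c (sheafify_unit C J F c x) = sheafify_unit C J G c (\<alpha> c x)"
  using assms psh_hom_val[OF plus_unit_hom[OF assms(1)]] psh_hom_val[OF assms(2)]
  by (simp add: sheafify_map_def sheafify_unit_def psh_comp_apply plus_map_unit plus_presheaf plus_map_hom)

text \<open>
  Sheafification of a commutative square with corner \<open>H\<close>: both composites agree along the unit of
  \<open>F\<close>. The presheaves \<open>G\<close> and \<open>G'\<close> may take values in different types, as is the case in the
  naturality square of \<open>eta\<close>.
\<close>

lemma sheafify_square:
  assumes F: "is_presheaf C F"
    and \<alpha>: "\<alpha> \<in> psh_hom C F G" "\<alpha>' \<in> psh_hom C F G'"
    and \<beta>: "\<beta> \<in> psh_hom C G H" "\<beta>' \<in> psh_hom C G' H"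
    and G: "is_presheaf C G" "is_presheaf C G'"
    and eq: "\<And>c x. c \<in> Obj C \<Longrightarrow> x \<in> Sec F c \<Longrightarrow> \<beta> c (\<alpha> c x) = \<beta>' c (\<alpha>' c x)"
  shows "psh_comp C (sheafify C J F) (sheafify_map C J G H \<beta>) (sheafify_map C J F G \<alpha>)
    = psh_comp C (sheafify C J F) (sheafify_map C J G' H \<beta>') (sheafify_map C J F G' \<alpha>')"
proof (rule hom_eq_if_eq_on_locally_surjective[OF sheafify_unit_locally_surjective[OF F]])
  fix c x assume "c \<in> Obj C" "x \<in> Sec F c"
  then show "psh_comp C (sheafify C J F) (sheafify_map C J G H \<beta>) (sheafify_map C J F G \<alpha>) c
      (sheafify_unit C J F c x)
    = psh_comp C (sheafify C J F) (sheafify_map C J G' H \<beta>') (sheafify_map C J F G' \<alpha>') c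
      (sheafify_unit C J F c x)"
    using eq psh_hom_val[OF sheafify_unit_hom[OF F]] psh_hom_val[OF \<alpha>(1)] psh_hom_val[OF \<alpha>(2)]
    by (simp add: psh_comp_apply sheafify_map_unit[OF F] sheafify_map_unit[OF G(1)]
        sheafify_map_unit[OF G(2)] \<alpha> \<beta>)
qed (rule psh_comp_hom[OF category_axioms sheafify_presheaf sheafify_map_hom[OF \<alpha>(1)]
      sheafify_map_hom[OF \<beta>(1)]]
    psh_comp_hom[OF category_axioms sheafify_presheaf sheafify_map_hom[OF \<alpha>(2)]
      sheafify_map_hom[OF \<beta>(2)]]
    sheafify_separated)+

lemma sheafify_map_comp:
  assumes F: "is_presheaf C F" and G: "is_presheaf C G" and \<alpha>: "\<alpha> \<in> psh_hom C F G"
    and \<beta>: "\<beta> \<in> psh_hom C G H" and \<gamma>: "\<gamma> \<in> psh_hom C F H"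
    and eq: "\<And>c x. c \<in> Obj C \<Longrightarrow> x \<in> Sec F c \<Longrightarrow> \<beta> c (\<alpha> c x) = \<gamma> c x"
  shows "psh_comp C (sheafify C J F) (sheafify_map C J G H \<beta>) (sheafify_map C J F G \<alpha>)
    = sheafify_map C J F H \<gamma>"
proof (rule hom_eq_if_eq_on_locally_surjective[OF sheafify_unit_locally_surjective[OF F]])
  fix c x assume "c \<in> Obj C" "x \<in> Sec F c"
  then show "psh_comp C (sheafify C J F) (sheafify_map C J G H \<beta>) (sheafify_map C J F G \<alpha>) c
      (sheafify_unit C J F c x) = sheafify_map C J F H \<gamma> c (sheafify_unit C J F c x)"
    using eq psh_hom_val[OF sheafify_unit_hom[OF F]] psh_hom_val[OF \<alpha>]
    by (simp add: psh_comp_apply sheafify_map_unit[OF F] sheafify_map_unit[OF G] \<alpha> \<beta> \<gamma>)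
qed (rule psh_comp_hom[OF category_axioms sheafify_presheaf sheafify_map_hom[OF \<alpha>]
      sheafify_map_hom[OF \<beta>]]
    sheafify_map_hom[OF \<gamma>] sheafify_separated)+

end


section \<open>Representable presheaves and their sheafifications\<close>

context category
begin

lemma yoneda_presheaf: "is_presheaf C (yoneda C c)"
  by (auto simp: is_presheaf_def yoneda_def hom_def comp_assoc_arr)

lemma yoneda_map_hom:
  assumes "f \<in> Arr C"
  shows "yoneda_map C f \<in> psh_hom C (yoneda C (Dom C f)) (yoneda C (Cod C f))"
proof -
  have "(\<lambda>x \<in> Obj C. \<lambda>g \<in> Sec (yoneda C (Dom C f)) x. f \<cdot> g)
    \<in> psh_hom C (yoneda C (Dom C f)) (yoneda C (Cod C f))"
    by (rule psh_homI[OF _ _ category_axioms yoneda_presheaf])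
      (use assms in \<open>auto simp: yoneda_def hom_def comp_assoc_arr\<close>)
  then show ?thesis by (simp add: yoneda_map_def yoneda_def)
qed

lemma yoneda_map_apply:
  "x \<in> Obj C \<Longrightarrow> g \<in> hom C x (Dom C f) \<Longrightarrow> yoneda_map C f x g = f \<cdot> g"
  by (simp add: yoneda_map_def)

end

context site
begin

lemma l_obj_sheaf: "is_sheaf C J (l_obj C J c)"
  unfolding l_obj_def by (rule sheafify_sheaf[OF yoneda_presheaf])

lemma l_map_hom: "f \<in> Arr C \<Longrightarrow> l_map C J f \<in> psh_hom C (l_obj C J (Dom C f)) (l_obj C J (Cod C f))"
  unfolding l_obj_def l_map_def by (intro sheafify_map_hom yoneda_map_hom)

lemma l_map_comp:
  assumes "f \<in> Arr C" "g \<in> Arr C" "Cod C g = Dom C f"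
  shows "psh_comp C (l_obj C J (Dom C g)) (l_map C J f) (l_map C J g) = l_map C J (f \<cdot> g)"
proof -
  have "psh_comp C (sheafify C J (yoneda C (Dom C g)))
      (sheafify_map C J (yoneda C (Dom C f)) (yoneda C (Cod C f)) (yoneda_map C f))
      (sheafify_map C J (yoneda C (Dom C g)) (yoneda C (Dom C f)) (yoneda_map C g))
    = sheafify_map C J (yoneda C (Dom C g)) (yoneda C (Cod C f)) (yoneda_map C (f \<cdot> g))"
    by (rule sheafify_map_comp[OF yoneda_presheaf yoneda_presheaf])
      (use assms yoneda_map_hom[of f] yoneda_map_hom[of g] yoneda_map_hom[of "f \<cdot> g"] in
        \<open>auto simp: yoneda_def yoneda_map_def hom_def comp_assoc_arr\<close>)
  then show ?thesis using assms by (simp add: l_obj_def l_map_def)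
qed

abbreviation l_unit :: "'o \<Rightarrow> 'o \<Rightarrow> 'a \<Rightarrow> ('a, 'a) shf" where
  "l_unit d \<equiv> sheafify_unit C J (yoneda C d)"

lemma l_unit_Sec: "c \<in> Obj C \<Longrightarrow> g \<in> hom C c d \<Longrightarrow> l_unit d c g \<in> Sec (l_obj C J d) c"
  using psh_hom_val[OF sheafify_unit_hom[OF yoneda_presheaf, of d], of c g]
  by (simp add: l_obj_def yoneda_def)

lemma l_unit_Res:
  assumes "g \<in> Arr C" "h \<in> Arr C" "Cod C h = Dom C g"
  shows "Res (l_obj C J (Cod C g)) h (l_unit (Cod C g) (Dom C g) g)
    = l_unit (Cod C g) (Dom C h) (g \<cdot> h)"
  using psh_hom_nat[OF sheafify_unit_hom[OF yoneda_presheaf, of "Cod C g"], of h g] assms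
  by (simp add: l_obj_def yoneda_def hom_def)

lemma l_map_unit:
  assumes "f \<in> Arr C" "g \<in> Arr C" "Cod C g = Dom C f"
  shows "l_map C J f (Dom C g) (l_unit (Dom C f) (Dom C g) g)
    = l_unit (Cod C f) (Dom C g) (f \<cdot> g)"
  using sheafify_map_unit[OF yoneda_presheaf yoneda_map_hom[OF assms(1)], of "Dom C g" g] assms
    dom_obj[OF assms(2)]
  by (simp add: l_map_def yoneda_map_def yoneda_def hom_def)

text \<open>
  Passage from sheaves back to the site. The section \<open>\<kappa> (id)\<close> of \<open>l (Dom g)\<close> is represented, locally
  on \<open>Dom h\<close>, by arrows \<open>a\<close> into \<open>Dom g\<close>. For such a representative over \<open>r\<close>, the arrows \<open>g \<cdot> a\<close> and
  \<open>h \<cdot> r\<close> have the same image in \<open>l (Cod g)\<close>, so they agree after one more restriction.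
\<close>

lemma l_map_locally_factors:
  assumes g: "g \<in> Arr C" and h: "h \<in> Arr C" and cod: "Cod C h = Cod C g"
    and \<kappa>: "\<kappa> \<in> psh_hom C (l_obj C J (Dom C h)) (l_obj C J (Dom C g))"
    and eq: "psh_comp C (l_obj C J (Dom C h)) (l_map C J g) \<kappa> = l_map C J h"
  shows "{r \<in> Arr C. Cod C r = Dom C h \<and>
      (\<exists>a \<in> hom C (Dom C r) (Dom C g). h \<cdot> r = g \<cdot> a)} \<in> J (Dom C h)"
    (is "?T \<in> J _")
proof -
  let ?e = "Dom C h"
  have e: "?e \<in> Obj C" using dom_obj[OF h] .
  let ?one = "l_unit ?e ?e (Ident C ?e)"
  have one: "?one \<in> Sec (l_obj C J ?e) ?e" using l_unit_Sec[OF e ident_hom[OF e]] .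
  let ?y = "\<kappa> ?e ?one"
  have y: "?y \<in> Sec (l_obj C J (Dom C g)) ?e" using psh_hom_val[OF \<kappa> e one] .
  have gy: "l_map C J g ?e ?y = l_unit (Cod C g) ?e h"
    using l_map_unit[OF h, of "Ident C ?e"] e h cod psh_comp_apply[of ?e C ?one "l_obj C J ?e"] one eq
    by (metis comp_ident ident_arr)
  obtain R where R: "R \<in> J ?e" and lift:
    "\<And>r. r \<in> R \<Longrightarrow> \<exists>a \<in> hom C (Dom C r) (Dom C g).
      Res (l_obj C J (Dom C g)) r ?y = l_unit (Dom C g) (Dom C r) a"
    using sheafify_unit_locally_surjective[OF yoneda_presheaf, of "Dom C g"] e y
    unfolding locally_surjective_def l_obj_def by (fastforce simp: yoneda_def)
  have T: "sieve C ?e ?T"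
    unfolding sieve_def
  proof (intro conjI ballI impI)
    fix r q assume r: "r \<in> ?T" and q: "q \<in> Arr C" "Cod C q = Dom C r"
    then obtain a where a: "a \<in> hom C (Dom C r) (Dom C g)" "h \<cdot> r = g \<cdot> a" by blast
    then have "h \<cdot> (r \<cdot> q) = g \<cdot> (a \<cdot> q)" "a \<cdot> q \<in> hom C (Dom C q) (Dom C g)"
      using r q g h by (auto simp: hom_def comp_assoc_arr[symmetric])
    then show "r \<cdot> q \<in> ?T" using r q by auto
  qed auto
  show ?thesis
  proof (rule cover_local[OF e T R])
    fix r assume r: "r \<in> R"
    note ra = cover_arr[OF e R r]
    obtain a where a: "a \<in> Arr C" "Dom C a = Dom C r" "Cod C a = Dom C g"
      and ya: "Res (l_obj C J (Dom C g)) r ?y = l_unit (Dom C g) (Dom C r) a"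
      using lift[OF r] by (auto simp: hom_def)
    have "l_unit (Cod C g) (Dom C r) (g \<cdot> a) = l_map C J g (Dom C r) (l_unit (Dom C g) (Dom C r) a)"
      using l_map_unit[OF g a(1)] a by simp
    also have "\<dots> = Res (l_obj C J (Cod C g)) r (l_map C J g ?e ?y)"
      using psh_hom_nat[OF l_map_hom[OF g] ra(1), of ?y] ra(2) y ya by simp
    also have "\<dots> = l_unit (Cod C g) (Dom C r) (h \<cdot> r)"
      using l_unit_Res[OF h ra(1)] ra(2) cod gy by simp
    finally have "\<exists>R' \<in> J (Dom C r). \<forall>q \<in> R'. (g \<cdot> a) \<cdot> q = (h \<cdot> r) \<cdot> q"
      using sheafify_unit_locally_injective[OF yoneda_presheaf, of "Cod C g"] ra a g h cod
      unfolding locally_injective_def by (simp add: yoneda_def hom_def)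
    then obtain R' where R': "R' \<in> J (Dom C r)" "\<And>q. q \<in> R' \<Longrightarrow> (g \<cdot> a) \<cdot> q = (h \<cdot> r) \<cdot> q"
      by blast
    have "r \<cdot> q \<in> ?T" if q: "q \<in> R'" for q
    proof -
      note qa = cover_arr[OF ra(3) R'(1) q]
      have "h \<cdot> (r \<cdot> q) = g \<cdot> (a \<cdot> q)" "a \<cdot> q \<in> hom C (Dom C q) (Dom C g)"
        using R'(2)[OF q] qa ra a g h by (simp_all add: hom_def comp_assoc_arr)
      then show ?thesis using qa ra by auto
    qed
    then show "\<exists>R' \<in> J (Dom C r). \<forall>q \<in> R'. r \<cdot> q \<in> ?T" using R'(1) by blast
  qed
qed

end


section \<open>Locally cartesian arrows\<close>

context comorphism_of_sites
begin

lemma p_arr: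
  assumes "g \<in> Arr D"
  shows "on_arr p g \<in> Arr C" "Dom C (on_arr p g) = on_obj p (Dom D g)"
    "Cod C (on_arr p g) = on_obj p (Cod D g)"
  using map_hom[of g "Dom D g" "Cod D g"] assms by (auto simp: hom_def)

lemma p_comp:
  assumes "f \<in> Arr D" "g \<in> Arr D" "Cod D g = Dom D f"
  shows "on_arr p (f \<cdot>\<^bsub>D\<^esub> g) = on_arr p f \<cdot>\<^bsub>C\<^esub> on_arr p g"
  using map_comp[of g "Dom D g" "Dom D f" f "Cod D f"] assms by (auto simp: hom_def)

lemma precomp_presheaf:
  assumes E: "is_presheaf C E"
  shows "is_presheaf D (precomp p E)"
proof -
  have "Res E (on_arr p f) x \<in> Sec E (on_obj p (Dom D f))"
    if "f \<in> Arr D" "x \<in> Sec E (on_obj p (Cod D f))" for f x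
    using presheaf_res[OF E p_arr(1)[OF that(1)]] p_arr[OF that(1)] that(2) by simp
  then show ?thesis
    unfolding is_presheaf_def precomp_def
    by (auto simp: p_arr p_comp map_ident map_obj presheaf_comp[OF E] presheaf_ident[OF E])
qed

lemma precomp_hom:
  assumes k: "k \<in> psh_hom C E E'"
  shows "(\<lambda>d \<in> Obj D. k (on_obj p d)) \<in> psh_hom D (precomp p E) (precomp p E')"
proof -
  have "k (on_obj p (Dom D f)) (Res E (on_arr p f) x)
      = Res E' (on_arr p f) (k (on_obj p (Cod D f)) x)"
    if "f \<in> Arr D" "x \<in> Sec E (on_obj p (Cod D f))" for f x
    using psh_hom_nat[OF k p_arr(1)[OF that(1)]] p_arr[OF that(1)] that(2) by simp
  then show ?thesis
    using k map_obj source.dom_obj source.cod_obj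
    by (auto simp: PiE_iff psh_hom_def precomp_def)
qed

text \<open>
  The map of presheaves whose sheafification is \<open>eta\<close>.
\<close>

definition eta_pre :: "'p \<Rightarrow> 'p \<Rightarrow> 'b \<Rightarrow> ('a, 'a) shf" where
  "eta_pre d = (\<lambda>x \<in> Obj D. \<lambda>g \<in> hom D x d.
    sheafify_unit C J (yoneda C (on_obj p d)) (on_obj p x) (on_arr p g))"

lemma eta_eq: "eta D K C J p d = sheafify_map D K (yoneda D d) (precomp p (l_obj C J (on_obj p d))) (eta_pre d)"
  by (simp add: eta_def eta_pre_def)

lemma eta_pre_hom: "eta_pre d \<in> psh_hom D (yoneda D d) (precomp p (l_obj C J (on_obj p d)))"
proof -
  have "(\<lambda>x \<in> Obj D. \<lambda>g \<in> Sec (yoneda D d) x. target.l_unit (on_obj p d) (on_obj p x) (on_arr p g))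
    \<in> psh_hom D (yoneda D d) (precomp p (l_obj C J (on_obj p d)))"
  proof (rule psh_homI[OF _ _ source.category_axioms source.yoneda_presheaf])
    fix c g assume "c \<in> Obj D" "g \<in> Sec (yoneda D d) c"
    then show "target.l_unit (on_obj p d) (on_obj p c) (on_arr p g)
        \<in> Sec (precomp p (l_obj C J (on_obj p d))) c"
      using target.l_unit_Sec[OF map_obj map_hom] by (simp add: precomp_def yoneda_def)
  next
    fix h g assume "h \<in> Arr D" "g \<in> Sec (yoneda D d) (Cod D h)"
    then show "target.l_unit (on_obj p d) (on_obj p (Dom D h)) (on_arr p (Res (yoneda D d) h g))
      = Res (precomp p (l_obj C J (on_obj p d))) h
          (target.l_unit (on_obj p d) (on_obj p (Cod D h)) (on_arr p g))"
      using target.l_unit_Res[of "on_arr p g" "on_arr p h"]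
      by (auto simp: precomp_def yoneda_def hom_def p_arr p_comp)
  qed
  then show ?thesis by (simp add: eta_pre_def yoneda_def)
qed

lemma l_obj_presheaf: "is_presheaf C (l_obj C J c)"
  using target.l_obj_sheaf by (auto simp: is_sheaf_def)

lemma eta_obj_comma: "eta_obj D K C J p d \<in> comma_objs D K C J p"
  unfolding eta_obj_def comma_objs_def eta_eq
  using source.l_obj_sheaf target.l_obj_sheaf source.sheafify_map_hom[OF eta_pre_hom, of d]
  by (auto simp: inv_image_obj_def l_obj_def)

text \<open>
  Both composites are sheafifications of a map of presheaves that sends \<open>x\<close> to the image of
  \<open>p (g \<cdot> x) = p g \<cdot> p x\<close>.
\<close>

lemma eta_natural:
  assumes g: "g \<in> Arr D"
  shows "psh_comp D (l_obj D K (Dom D g)) (eta D K C J p (Cod D g)) (l_map D K g)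
    = psh_comp D (l_obj D K (Dom D g))
        (inv_image_map D K p (l_obj C J (on_obj p (Dom D g))) (l_obj C J (on_obj p (Cod D g)))
          (l_map C J (on_arr p g)))
        (eta D K C J p (Dom D g))"
  unfolding l_obj_def[of D] l_map_def[of D] eta_eq inv_image_map_def
proof (rule source.sheafify_square[OF source.yoneda_presheaf source.yoneda_map_hom[OF g]
      eta_pre_hom eta_pre_hom _ source.yoneda_presheaf precomp_presheaf[OF l_obj_presheaf]])
  have "l_map C J (on_arr p g)
      \<in> psh_hom C (l_obj C J (on_obj p (Dom D g))) (l_obj C J (on_obj p (Cod D g)))"
    using target.l_map_hom[OF p_arr(1)[OF g]] p_arr[OF g] by simp
  then show "(\<lambda>d \<in> Obj D. l_map C J (on_arr p g) (on_obj p d))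
      \<in> psh_hom D (precomp p (l_obj C J (on_obj p (Dom D g))))
          (precomp p (l_obj C J (on_obj p (Cod D g))))"
    by (rule precomp_hom)
  fix c x assume c: "c \<in> Obj D" and x: "x \<in> Sec (yoneda D (Dom D g)) c"
  then show "eta_pre (Cod D g) c (yoneda_map D g c x)
    = (\<lambda>d \<in> Obj D. l_map C J (on_arr p g) (on_obj p d)) c (eta_pre (Dom D g) c x)"
    using g target.l_map_unit[of "on_arr p g" "on_arr p x"]
    by (auto simp: yoneda_def eta_pre_def source.yoneda_map_apply hom_def p_arr p_comp)
qed

lemma eta_arr_comma:
  assumes g: "g \<in> Arr D"
  shows "eta_arr D K C J p g \<in> Arr (comma_cat D K C J p)"
  using eta_natural[OF g] eta_obj_comma[of "Dom D g"] eta_obj_comma[of "Cod D g"]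
    source.l_map_hom[OF g] target.l_map_hom[OF p_arr(1)[OF g]] p_arr[OF g]
  by (simp add: eta_arr_def comma_cat_def eta_obj_def)

text \<open>
  Cartesianness is tested on the image of \<open>h\<close> itself, over \<open>l_map t\<close>. The resulting factorization of
  sheaf morphisms descends locally to the site by \<open>l_map_locally_factors\<close>: this is the lifting of \<open>t\<close>
  that survives when a cartesian arrow is only locally cartesian.
\<close>

lemma locally_cartesian_lift:
  assumes g: "locally_cartesian D K C J p g" and h: "h \<in> Arr D" and cod: "Cod D h = Cod D g"
    and t: "t \<in> hom C (on_obj p (Dom D h)) (on_obj p (Dom D g))"
    and eq: "on_arr p g \<cdot>\<^bsub>C\<^esub> t = on_arr p h"
  shows "{r \<in> Arr D. Cod D r = Dom D h \<and>
      (\<exists>a \<in> hom D (Dom D r) (Dom D g). h \<cdot>\<^bsub>D\<^esub> r = g \<cdot>\<^bsub>D\<^esub> a)} \<in> K (Dom D h)"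
proof -
  let ?l = "\<lambda>d. l_obj C J (on_obj p d)"
  have ga: "g \<in> Arr D" and cart: "cartesian_arrow (comma_cat D K C J p) (sheaf_cat C J) comma_proj
      (eta_arr D K C J p g)"
    using g by (auto simp: locally_cartesian_def)
  have ta: "t \<in> Arr C" "Dom C t = on_obj p (Dom D h)" "Cod C t = on_obj p (Dom D g)"
    using t by (auto simp: hom_def)
  let ?w = "(?l (Dom D h), l_map C J t, ?l (Dom D g))"
  have w: "?w \<in> hom (sheaf_cat C J) (on_obj comma_proj (Dom (comma_cat D K C J p) (eta_arr D K C J p h)))
      (on_obj comma_proj (Dom (comma_cat D K C J p) (eta_arr D K C J p g)))"
    using target.l_map_hom[OF ta(1)] ta target.l_obj_sheaf
    by (simp add: hom_def sheaf_cat_def comma_proj_def comma_cat_def eta_arr_def eta_obj_def)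
  have codh: "Cod (comma_cat D K C J p) (eta_arr D K C J p h)
      = Cod (comma_cat D K C J p) (eta_arr D K C J p g)"
    using cod by (simp add: comma_cat_def eta_arr_def)
  have tri: "on_arr comma_proj (eta_arr D K C J p g) \<cdot>\<^bsub>sheaf_cat C J\<^esub> ?w
      = on_arr comma_proj (eta_arr D K C J p h)"
    using target.l_map_comp[OF p_arr(1)[OF ga] ta(1)] ta p_arr[OF ga] eq cod
    by (simp add: sheaf_cat_def comma_proj_def eta_arr_def eta_obj_def)
  obtain k where k: "k \<in> hom (comma_cat D K C J p)
        (Dom (comma_cat D K C J p) (eta_arr D K C J p h))
        (Dom (comma_cat D K C J p) (eta_arr D K C J p g))"
      "eta_arr D K C J p g \<cdot>\<^bsub>comma_cat D K C J p\<^esub> k = eta_arr D K C J p h"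
    using cart eta_arr_comma[OF h] w codh tri unfolding cartesian_arrow_def by metis
  obtain X \<kappa> l Y where k_eq: "k = (X, \<kappa>, l, Y)" by (cases k)
  have XY: "X = eta_obj D K C J p (Dom D h)" "Y = eta_obj D K C J p (Dom D g)"
    using k(1) k_eq by (auto simp: hom_def comma_cat_def eta_arr_def)
  have "\<kappa> \<in> psh_hom D (l_obj D K (Dom D h)) (l_obj D K (Dom D g))"
    using k(1) k_eq XY by (auto simp: hom_def comma_cat_def eta_obj_def)
  moreover have "psh_comp D (l_obj D K (Dom D h)) (l_map D K g) \<kappa> = l_map D K h"
    using k(2) k_eq XY by (simp add: comma_cat_def eta_obj_def eta_arr_def)
  ultimately show ?thesis
    using source.l_map_locally_factors[OF ga h cod] by blast
qed

end

theorem proposition3p2p4: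
  fixes D :: "('p, 'b) cat" and K :: "'p \<Rightarrow> 'b set set"
    and C :: "('o, 'a) cat" and J :: "'o \<Rightarrow> 'a set set"
    and p :: "('p, 'b, 'o, 'a) cat_map" and f :: 'b and d' d :: 'p
  assumes "local_fibration D K C J p"
    and "f \<in> hom D d' d"
  shows "\<exists>(I :: 'b set) (dv :: 'b \<Rightarrow> 'p) (dd :: 'b \<Rightarrow> 'p) (v :: 'b \<Rightarrow> 'b) (fhat :: 'b \<Rightarrow> 'b)
      (a :: 'b \<Rightarrow> 'b) (s :: 'b \<Rightarrow> 'a).
    covering_family D K d' I v \<and>
    (\<forall>i \<in> I. dv i \<in> Obj D \<and> dd i \<in> Obj D \<and>
      v i \<in> hom D (dv i) d' \<and>
      fhat i \<in> hom D (dd i) d \<and> locally_cartesian D K C J p (fhat i) \<and>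
      a i \<in> hom D (dv i) (dd i) \<and>
      s i \<in> hom C (on_obj p (dd i)) (on_obj p d') \<and>
      f \<cdot>\<^bsub>D\<^esub> v i = fhat i \<cdot>\<^bsub>D\<^esub> a i \<and>
      on_arr p f \<cdot>\<^bsub>C\<^esub> s i = on_arr p (fhat i))"
proof -
  interpret local_fibration D K C J p by fact
  have f: "f \<in> Arr D" "Dom D f = d'" "Cod D f = d" using assms(2) by (auto simp: hom_def)
  have d: "d \<in> Obj D" "d' \<in> Obj D" using f source.dom_obj source.cod_obj by auto
  obtain I :: "'a set" and dd uu uhat where cov: "covering_family C J (on_obj p d') I uu"
    and lift: "\<And>i. i \<in> I \<Longrightarrow> dd i \<in> Obj D \<and> uu i \<in> hom C (on_obj p (dd i)) (on_obj p d') \<and>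
        uhat i \<in> hom D (dd i) d \<and> locally_cartesian D K C J p (uhat i) \<and>
        on_arr p f \<cdot>\<^bsub>C\<^esub> uu i = on_arr p (uhat i)"
    using local_lifting[OF d(1) map_hom[OF assms(2)]] by blast
  obtain R where R: "R \<in> K d'" "on_arr p ` R \<subseteq> generated_sieve C (uu ` I)"
    using cover_lifting[OF d(2)] cov unfolding covering_family_def by blast
  \<comment> \<open>The sieve below serves as its own index set.\<close>
  let ?good = "\<lambda>h i a. i \<in> I \<and> a \<in> hom D (Dom D h) (dd i) \<and> f \<cdot>\<^bsub>D\<^esub> h = uhat i \<cdot>\<^bsub>D\<^esub> a"
  let ?T = "{h \<in> Arr D. Cod D h = d' \<and> (\<exists>i a. ?good h i a)}"
  have T: "sieve D d' ?T"
    unfolding sieve_def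
  proof (intro conjI ballI impI)
    fix h g assume h: "h \<in> ?T" and g: "g \<in> Arr D" "Cod D g = Dom D h"
    then obtain i a where ia: "?good h i a" by blast
    have "uhat i \<in> Arr D" "Dom D (uhat i) = dd i" using lift ia by (auto simp: hom_def)
    then have "?good (h \<cdot>\<^bsub>D\<^esub> g) i (a \<cdot>\<^bsub>D\<^esub> g)"
      using ia h g f by (auto simp: hom_def source.comp_assoc_arr[symmetric])
    then show "h \<cdot>\<^bsub>D\<^esub> g \<in> ?T" using h g by auto
  qed auto
  have "?T \<in> K d'"
  proof (rule source.cover_local[OF d(2) T R(1)])
    fix w assume w: "w \<in> R"
    note wa = source.cover_arr[OF d(2) R(1) w]
    obtain i t where i: "i \<in> I" and t: "t \<in> Arr C" "Cod C t = Dom C (uu i)"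
      and wt: "on_arr p w = uu i \<cdot>\<^bsub>C\<^esub> t"
      using R(2) w by (auto simp: generated_sieve_def)
    have u: "uu i \<in> Arr C" "Dom C (uu i) = on_obj p (dd i)" "Cod C (uu i) = on_obj p d'"
      "uhat i \<in> Arr D" "Dom D (uhat i) = dd i" "Cod D (uhat i) = d"
      and lc: "locally_cartesian D K C J p (uhat i)"
      and fu: "on_arr p f \<cdot>\<^bsub>C\<^esub> uu i = on_arr p (uhat i)"
      using lift[OF i] by (auto simp: hom_def)
    have fw: "f \<cdot>\<^bsub>D\<^esub> w \<in> Arr D" "Dom D (f \<cdot>\<^bsub>D\<^esub> w) = Dom D w" "Cod D (f \<cdot>\<^bsub>D\<^esub> w) = d"
      using f wa by simp_all
    have "Dom C t = on_obj p (Dom D w)"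
      using p_arr(2)[OF wa(1)] wt t u by simp
    then have t': "t \<in> hom C (on_obj p (Dom D (f \<cdot>\<^bsub>D\<^esub> w))) (on_obj p (Dom D (uhat i)))"
      using t u fw by (simp add: hom_def)
    have "on_arr p (uhat i) \<cdot>\<^bsub>C\<^esub> t = on_arr p f \<cdot>\<^bsub>C\<^esub> (uu i \<cdot>\<^bsub>C\<^esub> t)"
      unfolding fu[symmetric] using t u f by (simp add: target.comp_assoc_arr p_arr)
    also have "\<dots> = on_arr p (f \<cdot>\<^bsub>D\<^esub> w)"
      using wt p_comp[of f w] f wa by simp
    finally have "{r \<in> Arr D. Cod D r = Dom D w \<and>
        (\<exists>a \<in> hom D (Dom D r) (dd i). (f \<cdot>\<^bsub>D\<^esub> w) \<cdot>\<^bsub>D\<^esub> r = uhat i \<cdot>\<^bsub>D\<^esub> a)} \<in> K (Dom D w)"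
      (is "?Q \<in> _")
      using locally_cartesian_lift[OF lc fw(1) _ t'] fw u by simp
    moreover have "w \<cdot>\<^bsub>D\<^esub> r \<in> ?T" if "r \<in> ?Q" for r
    proof -
      obtain a where ra: "r \<in> Arr D" "Cod D r = Dom D w"
        and a: "a \<in> hom D (Dom D r) (dd i)" "(f \<cdot>\<^bsub>D\<^esub> w) \<cdot>\<^bsub>D\<^esub> r = uhat i \<cdot>\<^bsub>D\<^esub> a"
        using \<open>r \<in> ?Q\<close> by blast
      have "?good (w \<cdot>\<^bsub>D\<^esub> r) i a"
        using ra a wa f i by (simp add: source.comp_assoc_arr)
      then show ?thesis using ra wa by auto
    qed
    ultimately show "\<exists>R' \<in> K (Dom D w). \<forall>r \<in> R'. w \<cdot>\<^bsub>D\<^esub> r \<in> ?T"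
      by (intro bexI[of _ ?Q] ballI)
  qed
  then have cov_T: "covering_family D K d' ?T (\<lambda>h. h)"
    using source.generated_sieve_of_sieve[OF T] by (simp add: covering_family_def)
  define i where "i h = (SOME i. \<exists>a. ?good h i a)" for h
  define a where "a h = (SOME a. ?good h (i h) a)" for h
  have ia: "?good h (i h) (a h)" if "h \<in> ?T" for h
  proof -
    have "\<exists>i a. ?good h i a" using that by blast
    then have "\<exists>a. ?good h (i h) a" unfolding i_def by (rule someI_ex)
    then show ?thesis unfolding a_def by (rule someI_ex)
  qed
  show ?thesis
  proof (intro exI conjI ballI)
    show "covering_family D K d' ?T (\<lambda>h. h)" by (fact cov_T)
    fix h assume h: "h \<in> ?T"
    note good = ia[OF h] and lift_h = lift[OF conjunct1[OF ia[OF h]]]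
    show "Dom D h \<in> Obj D" "h \<in> hom D (Dom D h) d'"
      using h source.dom_obj by (auto simp: hom_def)
    show "dd (i h) \<in> Obj D" "uhat (i h) \<in> hom D (dd (i h)) d"
      "locally_cartesian D K C J p (uhat (i h))"
      "uu (i h) \<in> hom C (on_obj p (dd (i h))) (on_obj p d')"
      "on_arr p f \<cdot>\<^bsub>C\<^esub> uu (i h) = on_arr p (uhat (i h))"
      using lift_h by simp_all
    show "a h \<in> hom D (Dom D h) (dd (i h))" "f \<cdot>\<^bsub>D\<^esub> h = uhat (i h) \<cdot>\<^bsub>D\<^esub> a h"
      using good by simp_all
  qed
qed

end
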